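(* Let $\{x^\nu\}$ be a sequence of iterates produced by the SPSA with $\gamma_\nu\downarrow0$. Let $\kappa\subseteq\{1,2,\dots\}$ be any infinite index set such that $\lim_{\nu(\in\kappa)\to\infty}\|x^{\nu+1}-x^\nu\|=0$ with probability 1, and let $x^\infty$ be an accumulation point of $\{x^\nu\}_{\nu\in\kappa}$. Assume that there are functions $\widetilde c_k(\bullet,\bullet;\bullet):X\times\Xi\times X\to\mathbb R$, $k\in[K]$, such that for all $x\in X$ the function $\widetilde c_k(x,\bullet;x^\infty)$ is measurable with $\mathbb E[\widetilde c_k(x,\tilde z;x^\infty)]<\infty$, and for all i.i.d. samples $\{z^s\}_{s=1}^\infty$ of $\tilde z$: -- for all $\{(y^\nu,u^\nu)\}\subseteq X\times X$ converging to $(x^\infty,x^\infty)$, $$\mathbb E[\widetilde c_k(x^\infty,\tilde z;x^\infty)]\ \le\ \liminf_{\nu(\in\kappa)\to\infty}\frac1{N_\nu}\sum_{s=1}^{N_\nu}\widehat c_k(y^\nu,z^s;\gamma_\nu;u^\nu)\quad\text{almost surely};$$ -- for all $\{(y^\nu,u^\nu)\}\subseteq X\times X$ converging to $(y^\infty,x^\infty)$ for some $y^\infty\in X$, $$\limsup_{\nu(\in\kappa)\to\infty}\frac1{N_\nu}\sum_{s=1}^{N_\nu}\widehat c_k(y^\nu,z^s;\gamma_\nu;u^\nu)\ \le\ \mathbb E[\widetilde c_k(y^\infty,\tilde z;x^\infty)]\quad\text{almost surely}.$$ Then, almost surely, the following two statements hold for $x^\infty$: (a) if there exists $\widehat x\in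 X$ satisfying $\mathbb E[\widetilde c_k(\widehat x,\tilde z;x^\infty)]\le\zeta_k$ for all $k\in[K]$ and also $$\frac1{\lambda_\infty}\mathbb E[\widehat c_0(\widehat x,\tilde z;x^\infty)]\le\frac1{\lambda_\infty}\mathbb E[\widehat c_0(x^\infty,\tilde z;x^\infty)],$$ then $\mathbb E[\widetilde c_k(x^\infty,\tilde z;x^\infty)]\le\zeta_k$ for all $k\in[K]$; (b) if in addition (to the existence of $\widehat x$ as in (a)) the closure condition holds: $$\emptyset\ne\bigcap_{k=1}^K\{x\in X:\mathbb E[\widetilde c_k(x,\tilde z;x^\infty)]\le\zeta_k\}\ \subseteq\ \mathrm{cl}\Big(\bigcap_{k=1}^K\{x\in X:\mathbb E[\widetilde c_k(x,\tilde z;x^\infty)]<\zeta_k\}\Big),$$ then $x^\infty$ is a B-stationary point of the problem $$\operatorname*{minimize}_{x\in X}\ \mathbb E[\widehat c_0(x,\tilde z;x^\infty)]+\frac{\rho_\infty}2\|x-x^\infty\|^2\quad\text{subject to}\quad\mathbb E[\widetilde c_k(x,\tilde z;x^\infty)]\le\zeta_k,\ \ \forall k\in[K].$$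
   Context: Notation: $[K]=\{1,\dots,K\}$; $1/\infty=0$; cl is closure; $f'(x;v)$ is the one-sided directional derivative; $\mathcal T(x;C)$ is the Bouligand tangent cone. A function is B-differentiable at a point if it is locally Lipschitz continuous and directionally differentiable there. A point $\bar x\in C$ is a B-stationary point of minimizing $f$ over $C$ if $f'(\bar x;v)\ge0$ for all $v\in\mathcal T(\bar x;C)$. Problem data. $X\subseteq\mathcal O\subseteq\mathbb R^n$ ($\mathcal O$ open), $\tilde z$ is a random vector with values in $\Xi\subseteq\mathbb R^d$, $\zeta_k\in\mathbb R$. For $\gamma>0$, $c_k(x,z;\gamma)=\sum_{\ell=1}^L c_{k\ell}(x,z;\gamma)$, $\bar c_k(x;\gamma)=\mathbb E[c_k(x,\tilde z;\gamma)]$ for $k\in[K]$, and $\bar c_0(x)=\mathbb E[c_0(x,\tilde z)]$. The problem considered is to minimize $\bar c_0(x)$ over $x\in X$ subject to $\bar c_k(x;\gamma)\le\zeta_k$, $k\in[K]$. Standing assumptions. (1) $X$ is a polytope (bounded polyhedron); $c_0(\bullet,z)\ge0$ on $X$ for all $z\in\Xi$. (2) $c_0(\bullet,z)$ is directionally differentiable and globally Lipschitz continuous with constant $\mathrm{Lip}_0(z)>0$, $\mathbb E[\mathrm{Lip}_0(\tilde z)]<\infty$. (3) There exist integrable $\mathrm{Lip}_{\rm c},\widehat{\mathrm{Lip}}_{\rm c}:\Xi\to(0,\infty)$ and a probability-one set $\Xi_{\rm c}$ with $\sup_{z\in\Xi_{\rm c}}\mathrm{Lip}_{\rm c}(z)<\infty$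 such that for all $k,\ell$, all $z\in\Xi_{\rm c}$, all $x,x^1,x^2\in X$ and $\gamma,\gamma_1,\gamma_2>0$: $|c_{k\ell}(x^1,z;\gamma)-c_{k\ell}(x^2,z;\gamma)|\le\frac{\mathrm{Lip}_{\rm c}(z)}{\gamma}\|x^1-x^2\|$ and $|c_{k\ell}(x,z;\gamma_1)-c_{k\ell}(x,z;\gamma_2)|\le\widehat{\mathrm{Lip}}_{\rm c}(z)[1+\|x\|]\,|\frac1{\gamma_1}-\frac1{\gamma_2}|$. (4) Each $\bar c_k(\bullet;\gamma)$ is directionally differentiable with $\bar c_k(\bullet;\gamma)'(\bar x;v)=\sum_{\ell=1}^L\mathbb E[c_{k\ell}(\bullet,\tilde z;\gamma)'(\bar x;v)]$ for all $\bar x\in X$, $\gamma>0$, $v\in\mathbb R^n$. (5) (Growth of Rademacher averages) For $f:X\times\Xi\to\mathbb R$ let $\mathbf R_N(f,\Xi)=\sup_{(\xi_1,\dots,\xi_N)\in\Xi^N}\mathbb E_\sigma\big[\sup_{x\in X}|\frac1N\sum_{i=1}^N\sigma_i f(x,\xi_i)|\big]$, with $\sigma_i$ i.i.d. uniform on $\{+1,-1\}$. There exist positive constants $W_0,W_1,W_2$ such that for all integers $N>0$ and all $\beta\in(0,1/2)$: $\mathbf R_N(c_0,\Xi)\le W_0/N^\beta$ and $\max_{k\in[K]}\mathbf R_N(c_k(\bullet,\bullet;\gamma),\Xi)\le \frac{W_1}{N^\beta}+\frac{W_2}{\gamma\sqrt N}$ for all $\gamma>0$. (6) (Surrogates) For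 every $\bar x\in X$, $z\in\Xi$, $k\in[K]$, $\gamma>0$ a function $\widehat c_k(\bullet,z;\gamma;\bar x)$ is given with: (a) it is B-differentiable on $X$; (b) $\widehat c_k(x,z;\gamma;\bar x)\ge c_k(x,z;\gamma)$ for all $x\in X$; (c) $\widehat c_k(\bar x,z;\gamma;\bar x)=c_k(\bar x,z;\gamma)$; (d) $\widehat c_k(\bullet,z;\gamma;\bullet)$ is upper semicontinuous on $X\times X$; (e) $\widehat c_k(\bullet,z;\gamma;\bar x)'(\bar x;d)=c_k(\bullet,z;\gamma)'(\bar x;d)$ for all $d\in\mathbb R^n$. A surrogate $\widehat c_0(\bullet,z;\bar x)$ of $c_0(\bullet,z)$ satisfying the same five conditions is also given. Parameters. $\{N_\nu\}_{\nu\ge0}$ is an increasing sequence of integers with $N_0=0$; $\{\lambda_\nu\}_{\nu\ge1}$ is nondecreasing, positive, with $\lambda_1=1$ and limit $\lambda_\infty\in[1,\infty]$; $\{\rho_\nu\}_{\nu\ge1}$ is positive with limit $\rho_\infty\in[0,\infty)$ and, for some constants $\alpha_2>\alpha_1>0$, $\frac{\alpha_1}\nu\le\frac{\rho_\nu}{\lambda_\nu}\le\frac{\alpha_2}\nu$ for all $\nu$; $\{\gamma_\nu\}_{\nu\ge1}$ is positive and nonincreasing with $\sum_{\nu\ge2}\sup_{x\in X}|\bar c_k(x;\gamma_\nu)-\bar c_k(x;\gamma_{\nu-1})|<\infty$ for $k\in[K]$. Moreover there exist $\beta\in(0,1/2)$, a positive integer $\bar\nu$ and positive scalars $\delta,c_1,c_2,c_3,c_4$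 with $c_3<\bar\nu$ and $\beta(1+c_1)>1+\delta$ such that $c_2\nu^{1+c_1}\le N_\nu\le N_{\nu-1}/(1-\frac{c_3}\nu)$ and $\gamma_\nu\ge c_4/\nu^\delta$ for all $\nu\ge\bar\nu$. SPSA algorithm. Let $z^1,z^2,\dots$ be i.i.d. samples of $\tilde z$ and $Z^{N}=\{z^s\}_{s=1}^N$. Start with an arbitrary $x^1\in X$; for $\nu=1,2,\dots$ let $x^{\nu+1}$ be a global minimizer over $x\in X$ of $$\widehat V_{\lambda_\nu}^{\rho_\nu}(x,Z^{N_\nu};\gamma_\nu;x^\nu)=\frac1{N_\nu}\sum_{s=1}^{N_\nu}\widehat c_0(x,z^s;x^\nu)+\lambda_\nu\sum_{k=1}^K\max\Big(\frac1{N_\nu}\sum_{s=1}^{N_\nu}\widehat c_k(x,z^s;\gamma_\nu;x^\nu)-\zeta_k,\,0\Big)+\frac{\rho_\nu}2\|x-x^\nu\|^2 .$$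
   Formalization: Added for the objective surrogate ĉ0, since the claim fails otherwise: finite expectations on O, an integrable majorant over X×X, B-differentiability on X of E[ĉ0(·,z̃;x̄)] for each x̄ in X, and measurability of ĉ0 as a random upper semicontinuous function. *)

theory Defs
  imports "HOL-Probability.Probability"
begin

section \<open>Nonsmooth analysis\<close>

definition has_dir_deriv ::
    "('a::real_normed_vector \<Rightarrow> real) \<Rightarrow> 'a \<Rightarrow> 'a \<Rightarrow> real \<Rightarrow> bool" where
  "has_dir_deriv f x v D \<longleftrightarrow> ((\<lambda>t. (f (x + t *\<^sub>R v) - f x) / t) \<longlongrightarrow> D) (at_right 0)"

definition dir_deriv :: "('a::real_normed_vector \<Rightarrow> real) \<Rightarrow> 'a \<Rightarrow> 'a \<Rightarrow> real" where
  "dir_deriv f x v = (THE D. has_dir_deriv f x v D)"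

definition dir_differentiable :: "('a::real_normed_vector \<Rightarrow> real) \<Rightarrow> 'a \<Rightarrow> bool" where
  "dir_differentiable f x \<longleftrightarrow> (\<forall>v. \<exists>D. has_dir_deriv f x v D)"

definition B_differentiable :: "('a::real_normed_vector \<Rightarrow> real) \<Rightarrow> 'a \<Rightarrow> bool" where
  "B_differentiable f x \<longleftrightarrow>
     (\<exists>e>0. \<exists>C. C-lipschitz_on (ball x e) f) \<and> dir_differentiable f x"

definition bouligand_tangent_cone :: "'a::real_normed_vector set \<Rightarrow> 'a \<Rightarrow> 'a set" where
  "bouligand_tangent_cone C x =
     {v. \<exists>(y :: nat \<Rightarrow> 'a) (t :: nat \<Rightarrow> real). (\<forall>i. y i \<in> C \<and> 0 < t i) \<and>
           y \<longlonglongrightarrow> x \<and> t \<longlonglongrightarrow> 0 \<and> (\<lambda>i. (y i - x) /\<^sub>R t i) \<longlonglongrightarrow> v}"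

definition B_stationary :: "('a::real_normed_vector \<Rightarrow> real) \<Rightarrow> 'a set \<Rightarrow> 'a \<Rightarrow> bool" where
  "B_stationary f C x \<longleftrightarrow>
     x \<in> C \<and> (\<forall>v\<in>bouligand_tangent_cone C x. \<exists>D. has_dir_deriv f x v D \<and> 0 \<le> D)"

definition usc_on :: "'a::topological_space set \<Rightarrow> ('a \<Rightarrow> real) \<Rightarrow> bool" where
  "usc_on S f \<longleftrightarrow> (\<forall>p\<in>S. \<forall>a>f p. eventually (\<lambda>q. f q < a) (at p within S))"

definition acc_point_along :: "nat set \<Rightarrow> (nat \<Rightarrow> 'a::topological_space) \<Rightarrow> 'a \<Rightarrow> bool" where
  "acc_point_along \<kappa> x l \<longleftrightarrow>
     (\<exists>r :: nat \<Rightarrow> nat. strict_mono r \<and> range r \<subseteq> \<kappa> \<and> (x \<circ> r) \<longlonglongrightarrow> l)"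

text \<open>The filter of \<open>\<nu>\<close> tending to infinity within the index set \<open>\<kappa>\<close>.\<close>

abbreviation along :: "nat set \<Rightarrow> nat filter" where
  "along \<kappa> \<equiv> inf sequentially (principal \<kappa>)"

section \<open>Expectations, samples, Rademacher averages\<close>

abbreviation expect :: "'w measure \<Rightarrow> ('w \<Rightarrow> 'z) \<Rightarrow> ('z \<Rightarrow> real) \<Rightarrow> real" where
  "expect M zt f \<equiv> integral\<^sup>L M (\<lambda>\<omega>. f (zt \<omega>))"

text \<open>The function \<open>f\<close> only matters on \<open>\<Xi>\<close>, so its measurability is required there.\<close>

definition finite_expect ::
    "'w measure \<Rightarrow> ('w \<Rightarrow> 'z::topological_space) \<Rightarrow> 'z set \<Rightarrow> ('z \<Rightarrow> real) \<Rightarrow> bool" where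
  "finite_expect M zt \<Xi> f \<longleftrightarrow>
     f \<in> borel_measurable (restrict_space borel \<Xi>) \<and> integrable M (\<lambda>\<omega>. f (zt \<omega>))"

text \<open>Samples are indexed from 1; the value at index 0 is irrelevant.\<close>

definition iid_samples ::
    "'w measure \<Rightarrow> ('w \<Rightarrow> 'z::topological_space) \<Rightarrow> 'z set \<Rightarrow> (nat \<Rightarrow> 'w \<Rightarrow> 'z) \<Rightarrow> bool" where
  "iid_samples M zt \<Xi> z \<longleftrightarrow>
     prob_space.indep_vars M (\<lambda>_. borel) z {1..} \<and>
     (\<forall>s\<ge>1. (\<forall>\<omega>\<in>space M. z s \<omega> \<in> \<Xi>) \<and> distr M borel (z s) = distr M borel zt)"

definition sample_avg :: "nat \<Rightarrow> (nat \<Rightarrow> 'w \<Rightarrow> 'z) \<Rightarrow> 'w \<Rightarrow> ('z \<Rightarrow> real) \<Rightarrow> real" where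
  "sample_avg n z \<omega> f = (\<Sum>s=1..n. f (z s \<omega>)) / real n"

text \<open>Extended-valued, so that the suprema need no boundedness proviso.\<close>

definition rademacher_avg ::
    "'x set \<Rightarrow> 'z set \<Rightarrow> nat \<Rightarrow> ('x \<Rightarrow> 'z \<Rightarrow> real) \<Rightarrow> ennreal" where
  "rademacher_avg X \<Xi> n f =
     (SUP \<xi>\<in>{1..n} \<rightarrow> \<Xi>.
        \<integral>\<^sup>+ \<sigma>. (SUP x\<in>X. ennreal \<bar>(\<Sum>i=1..n. \<sigma> i * f x (\<xi> i)) / real n\<bar>)
          \<partial>measure_pmf (Pi_pmf {1..n} 0 (\<lambda>_. pmf_of_set {1, - 1 :: real})))"

section \<open>Surrogates\<close>

definition is_surrogate ::
    "'z set \<Rightarrow> 'x set \<Rightarrow> ('x::real_normed_vector \<Rightarrow> 'z \<Rightarrow> real) \<Rightarrow> ('x \<Rightarrow> 'z \<Rightarrow> 'x \<Rightarrow> real) \<Rightarrow> bool" where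
  "is_surrogate \<Xi> X f h \<longleftrightarrow>
     (\<forall>z\<in>\<Xi>.
        (\<forall>xb\<in>X.
           (\<forall>x\<in>X. B_differentiable (\<lambda>x. h x z xb) x) \<and>
           (\<forall>x\<in>X. f x z \<le> h x z xb) \<and>
           h xb z xb = f xb z \<and>
           (\<forall>d. dir_deriv (\<lambda>x. h x z xb) xb d = dir_deriv (\<lambda>x. f x z) xb d)) \<and>
        usc_on (X \<times> X) (\<lambda>(x, xb). h x z xb))"

text \<open>
  Regularity that makes \<open>\<lambda>x. expect M zt (\<lambda>z. h x z xb)\<close> a meaningful objective and lets
  sample averages of \<open>h\<close> be compared with it: finite expectation, an integrable majorant on
  \<open>X \<times> X\<close>, a B-differentiable expectation, and measurability of \<open>h\<close> as a random
  upper semicontinuous function, i.e. \<open>- h\<close> is a normal integrand on \<open>X \<times> X\<close>: its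
  hypograph is a measurable multifunction of \<open>z\<close>. A majorant of the absolute value is not
  needed, since \<open>h\<close> is a majorant of a nonnegative function where this is used.
\<close>

definition regular_surrogate ::
    "'w measure \<Rightarrow> ('w \<Rightarrow> 'z::topological_space) \<Rightarrow> 'z set \<Rightarrow> 'x set \<Rightarrow> 'x set \<Rightarrow>
      ('x::real_normed_vector \<Rightarrow> 'z \<Rightarrow> 'x \<Rightarrow> real) \<Rightarrow> bool" where
  "regular_surrogate M zt \<Xi> \<O> X h \<longleftrightarrow>
     (\<forall>xb\<in>X. \<forall>x\<in>\<O>. finite_expect M zt \<Xi> (\<lambda>z. h x z xb)) \<and>
     (\<exists>g. finite_expect M zt \<Xi> g \<and> (\<forall>z\<in>\<Xi>. \<forall>x\<in>X. \<forall>xb\<in>X. h x z xb \<le> g z)) \<and>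
     (\<forall>xb\<in>X. \<forall>x\<in>X. B_differentiable (\<lambda>x. expect M zt (\<lambda>z. h x z xb)) x) \<and>
     (\<forall>U a. open U \<longrightarrow>
        {z\<in>\<Xi>. \<exists>(x, xb) \<in> U \<inter> X \<times> X. a < h x z xb} \<in> sets (restrict_space borel \<Xi>))"

section \<open>Problem data\<close>

text \<open>
  The argument order is \<open>c k \<ell> x z \<gamma>\<close> for the constraint pieces and \<open>hc k x z \<gamma> xb\<close>,
  \<open>hc0 x z xb\<close> for the surrogates at the reference point \<open>xb\<close>.
\<close>

definition constr ::
    "nat \<Rightarrow> (nat \<Rightarrow> nat \<Rightarrow> 'x \<Rightarrow> 'z \<Rightarrow> real \<Rightarrow> real) \<Rightarrow> nat \<Rightarrow> 'x \<Rightarrow> 'z \<Rightarrow> real \<Rightarrow> real" where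
  "constr L c k x z \<gamma> = (\<Sum>l=1..L. c k l x z \<gamma>)"

definition mean_constr ::
    "'w measure \<Rightarrow> ('w \<Rightarrow> 'z) \<Rightarrow> nat \<Rightarrow> (nat \<Rightarrow> nat \<Rightarrow> 'x \<Rightarrow> 'z \<Rightarrow> real \<Rightarrow> real) \<Rightarrow>
      nat \<Rightarrow> 'x \<Rightarrow> real \<Rightarrow> real" where
  "mean_constr M zt L c k x \<gamma> = expect M zt (\<lambda>z. constr L c k x z \<gamma>)"

locale spsa_problem = prob_space M
  for M :: "'w measure" +
  fixes zt :: "'w \<Rightarrow> real^'d"
    and \<Xi> :: "(real^'d) set"
    and \<O> X :: "(real^'n) set"
    and K L :: nat
    and c0 :: "real^'n \<Rightarrow> real^'d \<Rightarrow> real"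
    and c :: "nat \<Rightarrow> nat \<Rightarrow> real^'n \<Rightarrow> real^'d \<Rightarrow> real \<Rightarrow> real"
    and hc0 :: "real^'n \<Rightarrow> real^'d \<Rightarrow> real^'n \<Rightarrow> real"
    and hc :: "nat \<Rightarrow> real^'n \<Rightarrow> real^'d \<Rightarrow> real \<Rightarrow> real^'n \<Rightarrow> real"
  assumes random_zt: "zt \<in> borel_measurable M" "\<And>\<omega>. \<omega> \<in> space M \<Longrightarrow> zt \<omega> \<in> \<Xi>"
    and open_dom: "open \<O>" "X \<subseteq> \<O>"
    and polytope_X: "polytope X"
    and c0_nonneg: "\<And>x z. x \<in> X \<Longrightarrow> z \<in> \<Xi> \<Longrightarrow> 0 \<le> c0 x z"
    and c0_expect: "\<And>x. x \<in> \<O> \<Longrightarrow> finite_expect M zt \<Xi> (c0 x)"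
    and c_expect: "\<And>k l x \<gamma>. k \<in> {1..K} \<Longrightarrow> l \<in> {1..L} \<Longrightarrow> x \<in> \<O> \<Longrightarrow> 0 < \<gamma> \<Longrightarrow>
          finite_expect M zt \<Xi> (\<lambda>z. c k l x z \<gamma>)"
    and c0_dir: "\<And>x z. x \<in> \<O> \<Longrightarrow> z \<in> \<Xi> \<Longrightarrow> dir_differentiable (\<lambda>x. c0 x z) x"
    and c0_lipschitz: "\<exists>Lip0. finite_expect M zt \<Xi> Lip0 \<and>
          (\<forall>z\<in>\<Xi>. 0 < Lip0 z \<and> (Lip0 z)-lipschitz_on \<O> (\<lambda>x. c0 x z))"
    and c_lipschitz: "\<exists>Lipc Lipc' \<Xi>c.
          finite_expect M zt \<Xi> Lipc \<and> finite_expect M zt \<Xi> Lipc' \<and>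
          (\<forall>z\<in>\<Xi>. 0 < Lipc z \<and> 0 < Lipc' z) \<and>
          \<Xi>c \<in> sets (restrict_space borel \<Xi>) \<and> (AE \<omega> in M. zt \<omega> \<in> \<Xi>c) \<and>
          bdd_above (Lipc ` \<Xi>c) \<and>
          (\<forall>k\<in>{1..K}. \<forall>l\<in>{1..L}. \<forall>z\<in>\<Xi>c.
             (\<forall>x1\<in>X. \<forall>x2\<in>X. \<forall>\<gamma>>0.
                \<bar>c k l x1 z \<gamma> - c k l x2 z \<gamma>\<bar> \<le> Lipc z / \<gamma> * norm (x1 - x2)) \<and>
             (\<forall>x\<in>X. \<forall>\<gamma>1>0. \<forall>\<gamma>2>0.
                \<bar>c k l x z \<gamma>1 - c k l x z \<gamma>2\<bar>
                  \<le> Lipc' z * (1 + norm x) * \<bar>1 / \<gamma>1 - 1 / \<gamma>2\<bar>))"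
    and c_dir: "\<And>k l x z \<gamma>. k \<in> {1..K} \<Longrightarrow> l \<in> {1..L} \<Longrightarrow> x \<in> X \<Longrightarrow> z \<in> \<Xi> \<Longrightarrow> 0 < \<gamma> \<Longrightarrow>
          dir_differentiable (\<lambda>x. c k l x z \<gamma>) x"
    and c_dir_expect: "\<And>k l x \<gamma> v. k \<in> {1..K} \<Longrightarrow> l \<in> {1..L} \<Longrightarrow> x \<in> X \<Longrightarrow> 0 < \<gamma> \<Longrightarrow>
          finite_expect M zt \<Xi> (\<lambda>z. dir_deriv (\<lambda>x. c k l x z \<gamma>) x v)"
    and mean_constr_dir: "\<And>k x \<gamma> v. k \<in> {1..K} \<Longrightarrow> x \<in> X \<Longrightarrow> 0 < \<gamma> \<Longrightarrow>
          has_dir_deriv (\<lambda>x. mean_constr M zt L c k x \<gamma>) x v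
            (\<Sum>l=1..L. expect M zt (\<lambda>z. dir_deriv (\<lambda>x. c k l x z \<gamma>) x v))"
    and rademacher: "\<exists>W0>0. \<exists>W1>0. \<exists>W2>0. \<forall>n>0. \<forall>\<beta>\<in>{0<..<1/2}.
          rademacher_avg X \<Xi> n c0 \<le> ennreal (W0 / real n powr \<beta>) \<and>
          (\<forall>k\<in>{1..K}. \<forall>\<gamma>>0. rademacher_avg X \<Xi> n (\<lambda>x z. constr L c k x z \<gamma>)
             \<le> ennreal (W1 / real n powr \<beta> + W2 / (\<gamma> * sqrt (real n))))"
    and surrogate_constr: "\<And>k \<gamma>. k \<in> {1..K} \<Longrightarrow> 0 < \<gamma> \<Longrightarrow>
          is_surrogate \<Xi> X (\<lambda>x z. constr L c k x z \<gamma>) (\<lambda>x z xb. hc k x z \<gamma> xb)"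
    and surrogate_obj: "is_surrogate \<Xi> X c0 hc0"

section \<open>Parameters and iterates\<close>

text \<open>
  The argument \<open>cb k x \<gamma>\<close> stands for the mean constraint functions. Except for \<open>N\<close>, the
  sequences are indexed from 1, which is why the series below is shifted.
\<close>

definition spsa_parameters ::
    "(real^'n) set \<Rightarrow> nat \<Rightarrow> (nat \<Rightarrow> real^'n \<Rightarrow> real \<Rightarrow> real) \<Rightarrow> (nat \<Rightarrow> nat) \<Rightarrow>
      (nat \<Rightarrow> real) \<Rightarrow> ereal \<Rightarrow> (nat \<Rightarrow> real) \<Rightarrow> real \<Rightarrow> (nat \<Rightarrow> real) \<Rightarrow> bool" where
  "spsa_parameters X K cb N lam lam_inf rho rho_inf gam \<longleftrightarrow>
     strict_mono N \<and> N 0 = 0 \<and>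
     mono_on {1..} lam \<and> (\<forall>\<nu>\<ge>1. 0 < lam \<nu>) \<and> lam 1 = 1 \<and> (\<lambda>\<nu>. ereal (lam \<nu>)) \<longlonglongrightarrow> lam_inf \<and>
     (\<forall>\<nu>\<ge>1. 0 < rho \<nu>) \<and> rho \<longlonglongrightarrow> rho_inf \<and>
     (\<exists>\<alpha>1 \<alpha>2. 0 < \<alpha>1 \<and> \<alpha>1 < \<alpha>2 \<and>
        (\<forall>\<nu>\<ge>1. \<alpha>1 / real \<nu> \<le> rho \<nu> / lam \<nu> \<and> rho \<nu> / lam \<nu> \<le> \<alpha>2 / real \<nu>)) \<and>
     (\<forall>\<nu>\<ge>1. 0 < gam \<nu>) \<and> antimono_on {1..} gam \<and>
     (\<forall>k\<in>{1..K}. summable (\<lambda>j. SUP x\<in>X. \<bar>cb k x (gam (j + 2)) - cb k x (gam (j + 1))\<bar>)) \<and>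
     (\<exists>\<beta> \<nu>b \<delta> c1 c2 c3 c4.
        0 < \<beta> \<and> \<beta> < 1/2 \<and> 0 < (\<nu>b :: nat) \<and> 0 < \<delta> \<and> 0 < c1 \<and> 0 < c2 \<and> 0 < c3 \<and> 0 < c4 \<and>
        c3 < real \<nu>b \<and> 1 + \<delta> < \<beta> * (1 + c1) \<and>
        (\<forall>\<nu>\<ge>\<nu>b. c2 * real \<nu> powr (1 + c1) \<le> real (N \<nu>) \<and>
                real (N \<nu>) \<le> real (N (\<nu> - 1)) / (1 - c3 / real \<nu>) \<and>
                c4 / real \<nu> powr \<delta> \<le> gam \<nu>))"

definition penalized_avg ::
    "nat \<Rightarrow> (nat \<Rightarrow> real) \<Rightarrow> (real^'n \<Rightarrow> real^'d \<Rightarrow> real^'n \<Rightarrow> real) \<Rightarrow>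
      (nat \<Rightarrow> real^'n \<Rightarrow> real^'d \<Rightarrow> real \<Rightarrow> real^'n \<Rightarrow> real) \<Rightarrow>
      real \<Rightarrow> real \<Rightarrow> nat \<Rightarrow> (nat \<Rightarrow> 'w \<Rightarrow> real^'d) \<Rightarrow> 'w \<Rightarrow> real \<Rightarrow> real^'n \<Rightarrow> real^'n \<Rightarrow> real" where
  "penalized_avg K \<zeta> hc0 hc l r n z \<omega> \<gamma> xb x =
     sample_avg n z \<omega> (\<lambda>z. hc0 x z xb)
     + l * (\<Sum>k=1..K. max (sample_avg n z \<omega> (\<lambda>z. hc k x z \<gamma> xb) - \<zeta> k) 0)
     + r / 2 * (norm (x - xb))\<^sup>2"

definition spsa_iterates ::
    "'w measure \<Rightarrow> (real^'n) set \<Rightarrow> nat \<Rightarrow> (nat \<Rightarrow> real) \<Rightarrow>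
      (real^'n \<Rightarrow> real^'d \<Rightarrow> real^'n \<Rightarrow> real) \<Rightarrow>
      (nat \<Rightarrow> real^'n \<Rightarrow> real^'d \<Rightarrow> real \<Rightarrow> real^'n \<Rightarrow> real) \<Rightarrow>
      (nat \<Rightarrow> nat) \<Rightarrow> (nat \<Rightarrow> real) \<Rightarrow> (nat \<Rightarrow> real) \<Rightarrow> (nat \<Rightarrow> real) \<Rightarrow>
      (nat \<Rightarrow> 'w \<Rightarrow> real^'d) \<Rightarrow> (nat \<Rightarrow> 'w \<Rightarrow> real^'n) \<Rightarrow> bool" where
  "spsa_iterates M X K \<zeta> hc0 hc N lam rho gam z x \<longleftrightarrow>
     (\<forall>\<omega>\<in>space M. x 1 \<omega> \<in> X \<and>
        (\<forall>\<nu>\<ge>1. is_arg_min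
           (penalized_avg K \<zeta> hc0 hc (lam \<nu>) (rho \<nu>) (N \<nu>) z \<omega> (gam \<nu>) (x \<nu> \<omega>))
           (\<lambda>y. y \<in> X) (x (\<nu> + 1) \<omega>)))"

end

theory Submission
  imports Defs
begin

text \<open>
  Off a single null set, the two limit hypotheses on the sample averages of the constraint surrogates
  hold for all sequences at once, and a one-sided uniform law of large numbers for upper
  semicontinuous integrands controls the objective: along a subsequence of iterates converging to the
  accumulation point, averages of \<open>hc0 y\<close> are asymptotically at most their mean, and averages of
  \<open>hc0 \<ge> c0\<close> at the next iterate are asymptotically at least the mean of \<open>c0\<close> at the limit, where
  \<open>c0\<close> and \<open>hc0\<close> touch. Comparing the minimizer of the penalized average with a fixed point, after
  division by the penalty parameter, gives feasibility of the limit. Compared with a strictly feasible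
  point, whose penalty eventually vanishes, it shows that the limit minimizes the proximal objective
  over the strictly feasible set and hence over its closure; a minimizer is B-stationary.
\<close>

section \<open>A one-sided strong law of large numbers\<close>

text \<open>The maximum over \<open>j \<le> n\<close> of the sums of the first \<open>j\<close>
  terms, the empty sum included. Splitting off the first term makes the same maximum for the shifted
  sequence appear on the right, which is the identity that Garsia's argument needs.\<close>

primrec max_partial_sum :: "nat \<Rightarrow> (nat \<Rightarrow> real) \<Rightarrow> real" where
  "max_partial_sum 0 a = 0"
| "max_partial_sum (Suc n) a = max 0 (a 0 + max_partial_sum n (\<lambda>i. a (Suc i)))"

lemma max_partial_sum_nonneg: "0 \<le> max_partial_sum n a"
  by (cases n) auto

lemma sum_le_max_partial_sum: "j \<le> n \<Longrightarrow> (\<Sum>i<j. a i) \<le> max_partial_sum n a"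
proof (induction n arbitrary: j a)
  case (Suc n)
  show ?case
  proof (cases j)
    case (Suc j')
    with Suc.IH[of j' "\<lambda>i. a (Suc i)"] Suc.prems show ?thesis
      by (simp del: sum.lessThan_Suc add: sum.lessThan_Suc_shift)
  qed auto
qed auto

lemma max_partial_sum_mono: "max_partial_sum n a \<le> max_partial_sum (Suc n) a"
proof (induction n arbitrary: a)
  case (Suc n)
  from this[of "\<lambda>i. a (Suc i)"] show ?case by simp
qed auto

lemma max_partial_sum_le: "max_partial_sum n a \<le> (\<Sum>i<n. \<bar>a i\<bar>)"
proof (induction n arbitrary: a)
  case (Suc n)
  have "0 \<le> (\<Sum>i<n. \<bar>a (Suc i)\<bar>)" by (simp add: sum_nonneg)
  with Suc[of "\<lambda>i. a (Suc i)"] show ?case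
    by (simp del: sum.lessThan_Suc add: sum.lessThan_Suc_shift)
qed auto

text \<open>Formulated on sequence space: the expectation of the maximum then depends only on the
  law of the sequence, hence agrees for a sequence and its shift when these have equal laws.\<close>

lemma measurable_max_partial_sum:
  "max_partial_sum n \<in> borel_measurable (Pi\<^sub>M UNIV (\<lambda>_. borel))"
proof (induction n)
  case (Suc n)
  have "(\<lambda>a i. a (Suc i) :: real) \<in> measurable (Pi\<^sub>M UNIV (\<lambda>_. borel)) (Pi\<^sub>M UNIV (\<lambda>_. borel))"
    by (rule measurable_PiM_single') auto
  from measurable_compose[OF this Suc]
  have [measurable]: "(\<lambda>a. max_partial_sum n (\<lambda>i. a (Suc i))) \<in> borel_measurable (Pi\<^sub>M UNIV (\<lambda>_. borel))"
    by simp
  show ?case by simp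
qed auto

section \<open>Partial sums of i.i.d. variables with negative mean\<close>

context prob_space
begin

text \<open>Dropping the first \<open>m\<close> terms changes all later partial sums by the same
  finite amount, so boundedness above can be read off from the terms with index at least
  \<open>m\<close>. This prepares the zero-one law.\<close>

lemma tail_event_partial_sums_unbounded:
  fixes X :: "nat \<Rightarrow> 'a \<Rightarrow> real"
  assumes X: "\<And>i. random_variable borel (X i)"
  shows "{\<omega> \<in> space M. \<not> bdd_above (range (\<lambda>n. \<Sum>i<n. X i \<omega>))}
           \<in> tail_events (\<lambda>i. sigma_sets (space M) {X i -` A \<inter> space M |A. A \<in> sets borel})"
  (is "?E \<in> tail_events ?A")
  unfolding tail_events_def
proof (rule INT_I)
  fix m :: nat
  let ?N = "sigma (space M) (\<Union> (?A ` {m..}))"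
  have sub: "\<Union> (?A ` {m..}) \<subseteq> Pow (space M)"
    by (auto dest: sigma_sets_into_sp[rotated])
  have meas: "X i \<in> borel_measurable ?N" if "i \<ge> m" for i
  proof (rule measurableI)
    fix A :: "real set" assume "A \<in> sets borel"
    then have "X i -` A \<inter> space M \<in> \<Union> (?A ` {m..})"
      using that by (auto intro!: bexI[of _ i] sigma_sets.Basic)
    then show "X i -` A \<inter> space ?N \<in> sets ?N"
      using sub by (simp add: space_measure_of sets_measure_of)
  qed auto
  have "bdd_above (range (\<lambda>n. \<Sum>i<n. X i \<omega>)) \<longleftrightarrow> (\<exists>C::nat. \<forall>n. (\<Sum>i\<in>{m..<n}. X i \<omega>) \<le> C)" for \<omega>
  proof
    assume "bdd_above (range (\<lambda>n. \<Sum>i<n. X i \<omega>))"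
    then obtain B where B: "\<And>n. (\<Sum>i<n. X i \<omega>) \<le> B" by (auto simp: bdd_above_def)
    obtain C :: nat where C: "max 0 (B - (\<Sum>i<m. X i \<omega>)) \<le> C" using real_arch_simple by blast
    have "(\<Sum>i\<in>{m..<n}. X i \<omega>) \<le> C" for n
    proof (cases "m \<le> n")
      case True
      then have "(\<Sum>i<n. X i \<omega>) = (\<Sum>i<m. X i \<omega>) + (\<Sum>i\<in>{m..<n}. X i \<omega>)"
        by (simp add: lessThan_atLeast0 sum.atLeastLessThan_concat)
      with B[of n] C show ?thesis by linarith
    qed auto
    then show "\<exists>C::nat. \<forall>n. (\<Sum>i\<in>{m..<n}. X i \<omega>) \<le> C" by blast
  next
    assume "\<exists>C::nat. \<forall>n. (\<Sum>i\<in>{m..<n}. X i \<omega>) \<le> C"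
    then obtain C :: nat where C: "\<And>n. (\<Sum>i\<in>{m..<n}. X i \<omega>) \<le> C" by blast
    show "bdd_above (range (\<lambda>n. \<Sum>i<n. X i \<omega>))"
    proof (rule bdd_aboveI2)
      fix n
      \<comment> \<open>\<open>C\<close> says nothing about prefixes of length at most
        \<open>m\<close>; the sum of absolute values bounds all of them at once.\<close>
      have *: "(\<Sum>i<j. X i \<omega>) \<le> (\<Sum>i<m. \<bar>X i \<omega>\<bar>)" if "j \<le> m" for j
        using that by (intro order_trans[OF sum_mono[OF abs_ge_self] sum_mono2]) auto
      show "(\<Sum>i<n. X i \<omega>) \<le> (\<Sum>i<m. \<bar>X i \<omega>\<bar>) + C"
      proof (cases "m \<le> n")
        case True
        then have "(\<Sum>i<n. X i \<omega>) = (\<Sum>i<m. X i \<omega>) + (\<Sum>i\<in>{m..<n}. X i \<omega>)"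
          by (simp add: lessThan_atLeast0 sum.atLeastLessThan_concat)
        with *[of m] C[of n] show ?thesis by simp
      next
        case False
        with *[of n] show ?thesis by simp
      qed
    qed
  qed
  then have "?E = {\<omega> \<in> space ?N. \<not> (\<exists>C::nat. \<forall>n. (\<Sum>i\<in>{m..<n}. X i \<omega>) \<le> C)}"
    by (simp add: space_measure_of[OF sub])
  also have "\<dots> \<in> sets ?N"
  proof -
    have [measurable]: "(\<lambda>\<omega>. \<Sum>i\<in>{m..<n}. X i \<omega>) \<in> borel_measurable ?N" for n
      by (intro borel_measurable_sum) (auto intro: meas)
    show ?thesis by measurable
  qed
  finally show "?E \<in> sigma_sets (space M) (\<Union> (?A ` {m..}))"
    by (simp add: sets_measure_of[OF sub])
qed

lemma integrable_identically_distributed: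
  fixes X Y :: "'a \<Rightarrow> real"
  assumes "random_variable borel X" "random_variable borel Y"
    and "distr M borel X = distr M borel Y" "integrable M Y"
  shows "integrable M X" "expectation X = expectation Y"
proof -
  have "integrable (distr M borel Y) (\<lambda>u. u)" using assms(2,4) by (simp add: integrable_distr_eq)
  then have "integrable (distr M borel X) (\<lambda>u. u)" unfolding assms(3) .
  then show "integrable M X" using assms(1) by (simp add: integrable_distr_eq)
  have "expectation X = integral\<^sup>L (distr M borel X) (\<lambda>u. u)" using assms(1) by (simp add: integral_distr)
  also have "\<dots> = expectation Y" unfolding assms(3) using assms(2) by (simp add: integral_distr)
  finally show "expectation X = expectation Y" .
qed

lemma indep_sets_reindex:
  assumes indep: "indep_sets F (f ` I)" and inj: "inj_on f I"
  shows "indep_sets (\<lambda>i. F (f i)) I"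
proof (rule indep_setsI)
  show "F (f i) \<subseteq> events" if "i \<in> I" for i
    using indep that by (auto simp: indep_sets_def)
  fix A J assume J: "J \<noteq> {}" "J \<subseteq> I" "finite J" "\<forall>j\<in>J. A j \<in> F (f j)"
  have inj_J: "inj_on f J" using inj J(2) by (rule inj_on_subset)
  let ?B = "\<lambda>k. A (inv_into J f k)"
  have "prob (\<Inter>k\<in>f ` J. ?B k) = (\<Prod>k\<in>f ` J. prob (?B k))"
    using J inj_J by (intro indep_setsD[OF indep]) auto
  then show "prob (\<Inter>j\<in>J. A j) = (\<Prod>j\<in>J. prob (A j))"
    using inj_J by (simp add: prod.reindex)
qed

lemma indep_vars_reindex:
  assumes indep: "indep_vars N X (f ` I)" and inj: "inj_on f I"
  shows "indep_vars (\<lambda>i. N (f i)) (\<lambda>i. X (f i)) I"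
  using assms indep_sets_reindex[OF _ inj, of "\<lambda>i. {X i -` A \<inter> space M |A. A \<in> sets (N i)}"]
  unfolding indep_vars_def2 by auto

lemma indep_vars_indep_sets:
  assumes "indep_vars M' X I"
  shows "indep_sets (\<lambda>i. sigma_sets (space M) {X i -` A \<inter> space M |A. A \<in> sets (M' i)}) I"
  using assms unfolding indep_vars_def by blast

text \<open>
  Garsia's argument: let \<open>m\<^sub>n\<close> be the maximum of the first \<open>n\<close> partial sums and \<open>m'\<^sub>n\<close> the same
  maximum for the shifted sequence. Then \<open>m\<^sub>n\<^sub>+\<^sub>1 - m'\<^sub>n = max (- m'\<^sub>n) X\<^sub>0\<close> has nonnegative expectation and
  would converge to \<open>X\<^sub>0\<close> if the partial sums were unbounded.
\<close>

lemma AE_partial_sums_bounded: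
  fixes X :: "nat \<Rightarrow> 'a \<Rightarrow> real"
  assumes indep: "indep_vars (\<lambda>_. borel) X UNIV"
    and ident: "\<And>i. distr M borel (X i) = distr M borel (X 0)"
    and int: "integrable M (X 0)"
    and neg: "expectation (X 0) < 0"
  shows "AE \<omega> in M. bdd_above (range (\<lambda>n. \<Sum>i<n. X i \<omega>))"
proof -
  have rv [measurable]: "\<And>i. random_variable borel (X i)"
    using indep by (auto simp: indep_vars_def)
  have int_X: "integrable M (X i)" for i
    by (rule integrable_identically_distributed(1)[OF rv rv ident int])
  let ?P = "Pi\<^sub>M UNIV (\<lambda>_::nat. borel :: real measure)"
  \<comment> \<open>Independence makes the joint law the product of the marginals, so the sequence
    and its shift induce the same measure on sequence space.\<close>
  have distr_eq: "distr M ?P (\<lambda>\<omega> i. Y i \<omega>) = Pi\<^sub>M UNIV (\<lambda>_. distr M borel (X 0))"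
    if Y: "indep_vars (\<lambda>_. borel) Y UNIV" and Y_ident: "\<And>i. distr M borel (Y i) = distr M borel (X 0)" for Y
  proof -
    have "\<And>i. random_variable borel (Y i)" using Y by (auto simp: indep_vars_def)
    with Y have "distr M ?P (\<lambda>\<omega>. \<lambda>i\<in>UNIV. Y i \<omega>) = Pi\<^sub>M UNIV (\<lambda>i. distr M borel (Y i))"
      using indep_vars_iff_distr_eq_PiM[of UNIV Y "\<lambda>_. borel"] by blast
    then show ?thesis by (simp only: Y_ident restrict_UNIV)
  qed
  have distr_X: "distr M ?P (\<lambda>\<omega> i. X i \<omega>) = Pi\<^sub>M UNIV (\<lambda>_. distr M borel (X 0))"
    by (rule distr_eq[OF indep ident])
  have "indep_vars (\<lambda>_. borel) (\<lambda>i. X (Suc i)) UNIV"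
    using indep_vars_reindex[OF indep_vars_subset[OF indep], of Suc UNIV] by simp
  then have distr_Suc: "distr M ?P (\<lambda>\<omega> i. X (Suc i) \<omega>) = Pi\<^sub>M UNIV (\<lambda>_. distr M borel (X 0))"
    by (rule distr_eq[OF _ ident])
  define m where "m n \<omega> = max_partial_sum n (\<lambda>i. X i \<omega>)" for n \<omega>
  define m' where "m' n \<omega> = max_partial_sum n (\<lambda>i. X (Suc i) \<omega>)" for n \<omega>
  have maps [measurable]: "(\<lambda>\<omega> i. X i \<omega>) \<in> measurable M ?P" "(\<lambda>\<omega> i. X (Suc i) \<omega>) \<in> measurable M ?P"
    by (auto intro!: measurable_PiM_single')
  note [measurable] = measurable_max_partial_sum
  have m_meas [measurable]: "m n \<in> borel_measurable M" "m' n \<in> borel_measurable M" for n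
    unfolding m_def m'_def by measurable
  have int_m: "integrable M (m n)" for n
    by (rule Bochner_Integration.integrable_bound[of M "\<lambda>\<omega>. \<Sum>i<n. \<bar>X i \<omega>\<bar>"])
       (auto simp: m_def max_partial_sum_nonneg int_X intro!: AE_I2 order_trans[OF max_partial_sum_le])
  have int_m': "integrable M (m' n)" for n
    by (rule Bochner_Integration.integrable_bound[of M "\<lambda>\<omega>. \<Sum>i<n. \<bar>X (Suc i) \<omega>\<bar>"])
       (auto simp: m'_def max_partial_sum_nonneg int_X intro!: AE_I2 order_trans[OF max_partial_sum_le])
  have exp_eq: "expectation (m' n) = expectation (m n)" for n
  proof -
    have "expectation (m' n) = integral\<^sup>L (distr M ?P (\<lambda>\<omega> i. X (Suc i) \<omega>)) (max_partial_sum n)"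
      unfolding m'_def by (subst integral_distr) auto
    also have "\<dots> = integral\<^sup>L (distr M ?P (\<lambda>\<omega> i. X i \<omega>)) (max_partial_sum n)"
      by (simp add: distr_X distr_Suc)
    also have "\<dots> = expectation (m n)" unfolding m_def by (subst integral_distr) auto
    finally show ?thesis .
  qed
  have diff: "m (Suc n) \<omega> - m' n \<omega> = max (- m' n \<omega>) (X 0 \<omega>)" for n \<omega>
    by (simp add: m_def m'_def max_def)
  have nonneg: "0 \<le> expectation (\<lambda>\<omega>. max (- m' n \<omega>) (X 0 \<omega>))" for n
  proof -
    have "expectation (m n) \<le> expectation (m (Suc n))"
      by (intro integral_mono int_m) (unfold m_def, rule max_partial_sum_mono)
    then show ?thesis
      unfolding diff[symmetric] using int_m int_m' exp_eq[of n] by simp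
  qed
  let ?A = "\<lambda>i. sigma_sets (space M) {X i -` A \<inter> space M |A. A \<in> sets borel}"
  let ?E = "{\<omega> \<in> space M. \<not> bdd_above (range (\<lambda>n. \<Sum>i<n. X i \<omega>))}"
  have tail: "?E \<in> tail_events ?A"
    by (rule tail_event_partial_sums_unbounded[OF rv])
  have A: "?A i \<subseteq> events" for i
    by (rule sets.sigma_sets_subset) auto
  have E_ev: "?E \<in> events" using tail_events_sets[of ?A, OF A] tail by (rule subsetD)
  have "prob ?E = 0 \<or> prob ?E = 1"
    by (rule kolmogorov_0_1_law[OF _ _ tail])
       (auto intro!: sigma_algebra_sigma_sets indep_vars_indep_sets[OF indep])
  moreover have "prob ?E \<noteq> 1"
  proof
    assume "prob ?E = 1"
    then have "AE \<omega> in M. \<omega> \<in> ?E" using prob_eq_1[OF E_ev] by simp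
    then have lim: "AE \<omega> in M. (\<lambda>n. max (- m' n \<omega>) (X 0 \<omega>)) \<longlonglongrightarrow> X 0 \<omega>"
    proof eventually_elim
      case (elim \<omega>)
      \<comment> \<open>The threshold contains \<open>X 0 \<omega>\<close> because the sum starts
        with that term: what is left for the shifted sequence still exceeds
        \<open>\<bar>X 0 \<omega>\<bar>\<close>, so the maximum with \<open>- m' n \<omega>\<close>
        is eventually \<open>X 0 \<omega>\<close>.\<close>
      have "\<exists>j. \<bar>X 0 \<omega>\<bar> + X 0 \<omega> < (\<Sum>i<j. X i \<omega>)"
      proof (rule ccontr)
        assume "\<nexists>j. \<bar>X 0 \<omega>\<bar> + X 0 \<omega> < (\<Sum>i<j. X i \<omega>)"
        then have "bdd_above (range (\<lambda>n. \<Sum>i<n. X i \<omega>))"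
          by (intro bdd_aboveI2) (auto simp: not_less)
        with elim show False by simp
      qed
      then obtain j where j: "\<bar>X 0 \<omega>\<bar> + X 0 \<omega> < (\<Sum>i<j. X i \<omega>)" by blast
      have "max (- m' n \<omega>) (X 0 \<omega>) = X 0 \<omega>" if "n \<ge> j" for n
      proof (cases j)
        case 0
        with j show ?thesis using max_partial_sum_nonneg[of n "\<lambda>i. X (Suc i) \<omega>"]
          by (auto simp: m'_def)
      next
        case (Suc j')
        then have "\<bar>X 0 \<omega>\<bar> < (\<Sum>i<j'. X (Suc i) \<omega>)"
          using j by (simp del: sum.lessThan_Suc add: sum.lessThan_Suc_shift)
        also have "\<dots> \<le> m' n \<omega>"
          unfolding m'_def using Suc that by (intro sum_le_max_partial_sum) auto
        finally show ?thesis by auto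
      qed
      then have "eventually (\<lambda>n. max (- m' n \<omega>) (X 0 \<omega>) = X 0 \<omega>) sequentially"
        by (auto simp: eventually_sequentially)
      then show ?case by (rule tendsto_eventually)
    qed
    \<comment> \<open>Since \<open>m' n\<close> is nonnegative, the truncations are dominated by
      \<open>\<bar>X 0 \<omega>\<bar>\<close>; their nonnegative expectations then contradict
      \<open>neg\<close> in the limit.\<close>
    have "(\<lambda>n. expectation (\<lambda>\<omega>. max (- m' n \<omega>) (X 0 \<omega>))) \<longlonglongrightarrow> expectation (X 0)"
    proof (rule integral_dominated_convergence[where w = "\<lambda>\<omega>. \<bar>X 0 \<omega>\<bar>"])
      show "AE \<omega> in M. norm (max (- m' n \<omega>) (X 0 \<omega>)) \<le> \<bar>X 0 \<omega>\<bar>" for n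
      proof (rule AE_I2)
        fix \<omega>
        show "norm (max (- m' n \<omega>) (X 0 \<omega>)) \<le> \<bar>X 0 \<omega>\<bar>"
          using max_partial_sum_nonneg[of n "\<lambda>i. X (Suc i) \<omega>"] unfolding m'_def real_norm_def by linarith
      qed
    qed (use lim int in auto)
    then have "0 \<le> expectation (X 0)"
      by (rule LIMSEQ_le_const) (use nonneg in auto)
    with neg show False by simp
  qed
  ultimately have "prob ?E = 0" by blast
  then have "AE \<omega> in M. \<omega> \<notin> ?E" using prob_eq_0[OF E_ev] by simp
  then show ?thesis by (rule AE_mp) (auto intro!: AE_I2)
qed

text \<open>Center at a level \<open>a\<close> strictly between the mean and \<open>b\<close>. The
  centered sums are bounded above by some \<open>C\<close> depending on the sample path, so the
  averages are at most \<open>a + C / n\<close>, which drops below \<open>b\<close>.\<close>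

lemma AE_eventually_average_less:
  fixes X :: "nat \<Rightarrow> 'a \<Rightarrow> real"
  assumes indep: "indep_vars (\<lambda>_. borel) X UNIV"
    and ident: "\<And>i. distr M borel (X i) = distr M borel (X 0)"
    and int: "integrable M (X 0)"
    and b: "expectation (X 0) < b"
  shows "AE \<omega> in M. eventually (\<lambda>n. (\<Sum>i<n. X i \<omega>) / real n < b) sequentially"
proof -
  obtain a where a: "expectation (X 0) < a" "a < b" using dense[OF b] by blast
  have rv [measurable]: "\<And>i. random_variable borel (X i)"
    using indep by (auto simp: indep_vars_def)
  have "indep_vars (\<lambda>_. borel) (\<lambda>i \<omega>. X i \<omega> - a) UNIV"
    by (rule indep_vars_compose2[OF indep]) auto
  moreover have "distr M borel (\<lambda>\<omega>. X i \<omega> - a) = distr M borel (\<lambda>\<omega>. X 0 \<omega> - a)" for i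
  proof -
    have "distr M borel (\<lambda>\<omega>. X j \<omega> - a) = distr (distr M borel (X j)) borel (\<lambda>u. u - a)" for j
      by (subst distr_distr) (auto simp: o_def)
    then show ?thesis using ident[of i] by simp
  qed
  moreover have "expectation (\<lambda>\<omega>. X 0 \<omega> - a) < 0" using a int by (simp add: prob_space)
  ultimately have "AE \<omega> in M. bdd_above (range (\<lambda>n. \<Sum>i<n. X i \<omega> - a))"
    using int by (intro AE_partial_sums_bounded) auto
  then show ?thesis
  proof eventually_elim
    case (elim \<omega>)
    then obtain C where C: "\<And>n. (\<Sum>i<n. X i \<omega> - a) \<le> C" by (auto simp: bdd_above_def)
    have "((\<lambda>n. a + C / real n) \<longlongrightarrow> a + 0) sequentially"
      by (intro tendsto_intros lim_const_over_n)
    then have "eventually (\<lambda>n. a + C / real n < b) sequentially"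
      using a by (intro order_tendstoD) auto
    with eventually_gt_at_top[of 0] show ?case
    proof eventually_elim
      case (elim n)
      have "(\<Sum>i<n. X i \<omega>) \<le> n * a + C" using C[of n] by (simp add: sum_subtractf)
      then have "(\<Sum>i<n. X i \<omega>) / n \<le> a + C / n" using elim by (simp add: field_simps)
      with elim show ?case by simp
    qed
  qed
qed

end

section \<open>Sample averages of integrands defined on \<Xi>\<close>

lemma finite_expectD:
  assumes "finite_expect M zt \<Xi> f"
  shows "f \<in> borel_measurable (restrict_space borel \<Xi>)" "integrable M (\<lambda>\<omega>. f (zt \<omega>))"
  using assms by (simp_all add: finite_expect_def)

context prob_space
begin

text \<open>The integrand is measurable only on \<Xi>, so independence and equality of laws are
  first carried to the trace sigma-algebra \<open>restrict_space borel \<Xi>\<close>. This is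
  possible because all samples lie in \<Xi>.\<close>

lemma AE_eventually_sample_avg_less:
  assumes zt: "zt \<in> borel_measurable M" "\<And>\<omega>. \<omega> \<in> space M \<Longrightarrow> zt \<omega> \<in> \<Xi>"
    and iid: "iid_samples M zt \<Xi> z"
    and f: "finite_expect M zt \<Xi> f" and b: "expect M zt f < b"
  shows "AE \<omega> in M. eventually (\<lambda>n. sample_avg n z \<omega> f < b) sequentially"
proof -
  let ?R = "restrict_space borel \<Xi>"
  note f' [measurable] = finite_expectD[OF f]
  have z: "z s \<in> borel_measurable M" "\<And>\<omega>. \<omega> \<in> space M \<Longrightarrow> z s \<omega> \<in> \<Xi>"
    "distr M borel (z s) = distr M borel zt" if "s \<ge> 1" for s
    using iid that by (auto simp: iid_samples_def indep_vars_def)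
  have zt_R [measurable]: "zt \<in> measurable M ?R"
    using zt by (intro measurable_restrict_space2) auto
  have z_R: "z s \<in> measurable M ?R" if "s \<ge> 1" for s
    using z[OF that] by (intro measurable_restrict_space2) auto
  have "indep_vars (\<lambda>_. ?R) z {1..}"
    unfolding indep_vars_def2
  proof (intro conjI ballI z_R)
    have "indep_sets (\<lambda>s. {z s -` A \<inter> space M |A. A \<in> sets borel}) {1..}"
      using iid unfolding iid_samples_def indep_vars_def2 by auto
    then show "indep_sets (\<lambda>s. {z s -` A \<inter> space M |A. A \<in> sets ?R}) {1..}"
    proof (rule indep_sets_mono_sets)
      fix s :: nat assume "s \<in> {1..}"
      then have "z s -` (\<Xi> \<inter> A) \<inter> space M = z s -` A \<inter> space M" for A
        using z(2) by auto
      then show "{z s -` A \<inter> space M |A. A \<in> sets ?R} \<subseteq> {z s -` A \<inter> space M |A. A \<in> sets borel}"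
        by (force simp: sets_restrict_space)
    qed
  qed auto
  \<comment> \<open>Samples are numbered from 1, while the law for averages uses the index set
    \<open>UNIV\<close>; \<open>Suc\<close> converts.\<close>
  then have "indep_vars (\<lambda>_. ?R) z (range Suc)"
    by (rule indep_vars_subset) auto
  from indep_vars_reindex[OF this]
  have "indep_vars (\<lambda>_. borel) (\<lambda>i \<omega>. f (z (Suc i) \<omega>)) UNIV"
    by (intro indep_vars_compose2[where Y = "\<lambda>_. f" and M' = "\<lambda>_. ?R"] f'(1)) auto
  moreover have distr_eq: "distr M borel (\<lambda>\<omega>. f (z (Suc i) \<omega>)) = distr M borel (\<lambda>\<omega>. f (zt \<omega>))" for i
  proof -
    have "distr M ?R (z (Suc i)) = distr M ?R zt"
    proof (rule measure_eqI)
      fix A assume A: "A \<in> sets (distr M ?R (z (Suc i)))"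
      then obtain B where B: "A = \<Xi> \<inter> B" "B \<in> sets borel" by (auto simp: sets_restrict_space)
      have "z (Suc i) -` A \<inter> space M = z (Suc i) -` B \<inter> space M" "zt -` A \<inter> space M = zt -` B \<inter> space M"
        using B zt(2) z(2)[of "Suc i"] by auto
      moreover have "emeasure (distr M borel (z (Suc i))) B = emeasure (distr M borel zt) B"
        using z(3)[of "Suc i"] by simp
      ultimately show "emeasure (distr M ?R (z (Suc i))) A = emeasure (distr M ?R zt) A"
        using A B zt(1) z(1)[of "Suc i"] z_R[of "Suc i"] zt_R by (simp add: emeasure_distr)
    qed simp
    then have "distr (distr M ?R (z (Suc i))) borel f = distr (distr M ?R zt) borel f" by simp
    then show ?thesis
      using z_R[of "Suc i"] by (simp add: distr_distr o_def)
  qed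
  moreover have "integrable M (\<lambda>\<omega>. f (z (Suc 0) \<omega>))"
    "expectation (\<lambda>\<omega>. f (z (Suc 0) \<omega>)) = expect M zt f"
    by (rule integrable_identically_distributed[OF _ _ distr_eq f'(2)];
        use measurable_compose[OF z_R[of "Suc 0"] f'(1)] in simp)+
  ultimately have "AE \<omega> in M. eventually (\<lambda>n. (\<Sum>i<n. f (z (Suc i) \<omega>)) / real n < b) sequentially"
    using b by (intro AE_eventually_average_less) (auto simp only: distr_eq)
  then show ?thesis
    by (simp add: sample_avg_def sum.atLeast1_atMost_eq)
qed

text \<open>
  An upper semicontinuous integrand is dominated near \<open>p\<close> by its suprema over members of a countable
  basis, to which the law of large numbers applies simultaneously; their means decrease to the mean
  at \<open>p\<close> by dominated convergence.
\<close>

lemma AE_sample_avg_usc_integrand: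
  fixes h :: "'b::{metric_space, second_countable_topology} \<Rightarrow> 'z::topological_space \<Rightarrow> real"
  assumes zt: "zt \<in> borel_measurable M" "\<And>\<omega>. \<omega> \<in> space M \<Longrightarrow> zt \<omega> \<in> \<Xi>"
    and iid: "iid_samples M zt \<Xi> z"
    and h: "\<And>p. p \<in> S \<Longrightarrow> finite_expect M zt \<Xi> (h p)"
    and g: "finite_expect M zt \<Xi> g" "\<And>p \<xi>. p \<in> S \<Longrightarrow> \<xi> \<in> \<Xi> \<Longrightarrow> h p \<xi> \<le> g \<xi>"
    and meas: "\<And>U a. open U \<Longrightarrow> {\<xi>\<in>\<Xi>. \<exists>p\<in>U \<inter> S. a < h p \<xi>} \<in> sets (restrict_space borel \<Xi>)"
    and usc: "\<And>\<xi>. \<xi> \<in> \<Xi> \<Longrightarrow> usc_on S (\<lambda>p. h p \<xi>)"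
  shows "AE \<omega> in M. \<forall>p\<in>S. \<forall>b>expect M zt (h p). \<exists>U. open U \<and> p \<in> U \<and>
           eventually (\<lambda>n. \<forall>q\<in>U \<inter> S. sample_avg n z \<omega> (h q) < b) sequentially"
proof -
  let ?R = "restrict_space borel \<Xi>"
  have zt_R: "zt \<in> measurable M ?R"
    using zt by (intro measurable_restrict_space2) auto
  define H where "H U \<xi> = (SUP p\<in>U \<inter> S. h p \<xi>)" for U \<xi>
  have bdd: "bdd_above ((\<lambda>p. h p \<xi>) ` (U \<inter> S))" if "\<xi> \<in> \<Xi>" for U \<xi>
    using g(2) that by (intro bdd_aboveI2[of _ _ "g \<xi>"]) auto
  have H_ge: "h p \<xi> \<le> H U \<xi>" if "p \<in> U \<inter> S" "\<xi> \<in> \<Xi>" for p \<xi> U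
    unfolding H_def using that by (intro cSUP_upper bdd) auto
  have H_le: "H U \<xi> \<le> g \<xi>" if "U \<inter> S \<noteq> {}" "\<xi> \<in> \<Xi>" for \<xi> U
    unfolding H_def using that g(2) by (intro cSUP_least) auto
  have H_finite: "finite_expect M zt \<Xi> (H U)" if U: "open U" "U \<inter> S \<noteq> {}" for U
  proof -
    have H_R: "H U \<in> borel_measurable ?R"
    proof (rule borel_measurableI_greater)
      fix a
      have "{\<xi> \<in> space ?R. a < H U \<xi>} = {\<xi>\<in>\<Xi>. \<exists>p\<in>U \<inter> S. a < h p \<xi>}"
        unfolding H_def using less_cSUP_iff[OF U(2) bdd] by (auto simp: space_restrict_space)
      then show "{\<xi> \<in> space ?R. a < H U \<xi>} \<in> sets ?R" using meas[OF U(1)] by simp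
    qed
    \<comment> \<open>Only an upper bound is assumed uniformly on \<open>S\<close>; a single fixed
      \<open>p\<close> supplies the integrable lower bound of the supremum.\<close>
    obtain p where p: "p \<in> U \<inter> S" using U by blast
    have "integrable M (\<lambda>\<omega>. H U (zt \<omega>))"
    proof (rule Bochner_Integration.integrable_bound)
      show "integrable M (\<lambda>\<omega>. \<bar>g (zt \<omega>)\<bar> + \<bar>h p (zt \<omega>)\<bar>)"
        using finite_expectD(2)[OF g(1)] finite_expectD(2)[OF h[of p]] p by auto
      show "(\<lambda>\<omega>. H U (zt \<omega>)) \<in> borel_measurable M"
        by (rule measurable_compose[OF zt_R H_R])
      show "AE \<omega> in M. norm (H U (zt \<omega>)) \<le> norm (\<bar>g (zt \<omega>)\<bar> + \<bar>h p (zt \<omega>)\<bar>)"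
      proof (rule AE_I2)
        fix \<omega> assume "\<omega> \<in> space M"
        then have "h p (zt \<omega>) \<le> H U (zt \<omega>)" "H U (zt \<omega>) \<le> g (zt \<omega>)"
          using H_ge[OF p] H_le[OF U(2)] zt(2) by auto
        then show "norm (H U (zt \<omega>)) \<le> norm (\<bar>g (zt \<omega>)\<bar> + \<bar>h p (zt \<omega>)\<bar>)" by simp
      qed
    qed
    with H_R show ?thesis by (simp add: finite_expect_def)
  qed
  have small_nbhd: "\<exists>U. open U \<and> p \<in> U \<and> expect M zt (H U) < b"
    if p: "p \<in> S" and b: "expect M zt (h p) < b" for p b
  proof -
    let ?U = "\<lambda>n. ball p (1 / Suc n)"
    have U: "open (?U n)" "p \<in> ?U n \<inter> S" "?U n \<inter> S \<noteq> {}" for n using p centre_in_ball by fastforce+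
    have "(\<lambda>n. expect M zt (H (?U n))) \<longlonglongrightarrow> expect M zt (h p)"
    proof (rule integral_dominated_convergence[where w = "\<lambda>\<omega>. \<bar>g (zt \<omega>)\<bar> + \<bar>h p (zt \<omega>)\<bar>"])
      show "(\<lambda>\<omega>. h p (zt \<omega>)) \<in> borel_measurable M"
        by (intro borel_measurable_integrable finite_expectD(2)[OF h[OF p]])
      show "(\<lambda>\<omega>. H (?U n) (zt \<omega>)) \<in> borel_measurable M" for n
        by (rule borel_measurable_integrable[OF finite_expectD(2)[OF H_finite[OF U(1,3)]]])
      show "integrable M (\<lambda>\<omega>. \<bar>g (zt \<omega>)\<bar> + \<bar>h p (zt \<omega>)\<bar>)"
        using finite_expectD(2)[OF g(1)] finite_expectD(2)[OF h[OF p]] by auto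
      show "AE \<omega> in M. norm (H (?U n) (zt \<omega>)) \<le> \<bar>g (zt \<omega>)\<bar> + \<bar>h p (zt \<omega>)\<bar>" for n
      proof (rule AE_I2)
        fix \<omega> assume "\<omega> \<in> space M"
        then have "h p (zt \<omega>) \<le> H (?U n) (zt \<omega>)" "H (?U n) (zt \<omega>) \<le> g (zt \<omega>)"
          by (blast intro: H_ge[OF U(2)] H_le[OF U(3)] zt(2))+
        then show "norm (H (?U n) (zt \<omega>)) \<le> \<bar>g (zt \<omega>)\<bar> + \<bar>h p (zt \<omega>)\<bar>" by simp
      qed
      show "AE \<omega> in M. (\<lambda>n. H (?U n) (zt \<omega>)) \<longlonglongrightarrow> h p (zt \<omega>)"
      proof (rule AE_I2)
        fix \<omega> assume "\<omega> \<in> space M"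
        then have \<xi>: "zt \<omega> \<in> \<Xi>" by (rule zt(2))
        show "(\<lambda>n. H (?U n) (zt \<omega>)) \<longlonglongrightarrow> h p (zt \<omega>)"
        proof (rule order_tendstoI)
          fix a assume "a < h p (zt \<omega>)"
          then show "eventually (\<lambda>n. a < H (?U n) (zt \<omega>)) sequentially"
            by (intro always_eventually allI less_le_trans[OF _ H_ge[OF U(2) \<xi>]])
        next
          fix a assume "h p (zt \<omega>) < a"
          \<comment> \<open>A supremum of values below \<open>a'\<close> is only known to be at most
            \<open>a'\<close>, hence the intermediate level. The filter \<open>at p within S\<close>
            excludes \<open>p\<close> itself, so the case \<open>q = p\<close> is treated
            separately.\<close>
          then obtain a' where a': "h p (zt \<omega>) < a'" "a' < a" using dense by blast
          with usc[OF \<xi>] p have "eventually (\<lambda>q. h q (zt \<omega>) < a') (at p within S)"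
            by (auto simp: usc_on_def)
          then obtain d where d: "d > 0" "\<And>q. q \<in> S \<Longrightarrow> q \<noteq> p \<Longrightarrow> dist q p < d \<Longrightarrow> h q (zt \<omega>) < a'"
            by (auto simp: eventually_at)
          have "eventually (\<lambda>n. 1 / real (Suc n) < d) sequentially"
            using LIMSEQ_inverse_real_of_nat d(1) by (intro order_tendstoD(2)[of _ 0]) (simp_all add: inverse_eq_divide)
          then show "eventually (\<lambda>n. H (?U n) (zt \<omega>) < a) sequentially"
          proof eventually_elim
            case (elim n)
            have "H (?U n) (zt \<omega>) \<le> a'"
              unfolding H_def
            proof (rule cSUP_least)
              show "?U n \<inter> S \<noteq> {}" by (rule U(3))
              fix q assume "q \<in> ?U n \<inter> S"
              with elim d(2)[of q] a' show "h q (zt \<omega>) \<le> a'"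
                by (cases "q = p") (auto simp: dist_commute)
            qed
            with a' show ?case by simp
          qed
        qed
      qed
    qed
    then have "eventually (\<lambda>n. expect M zt (H (?U n)) < b) sequentially"
      using b by (rule order_tendstoD)
    then obtain n where "expect M zt (H (?U n)) < b" by (auto simp: eventually_sequentially)
    with U[of n] show ?thesis by blast
  qed
  obtain \<B> :: "'b set set" where \<B>: "countable \<B>" "topological_basis \<B>"
    using ex_countable_basis by blast
  \<comment> \<open>Rational levels keep the index set countable, so one null set serves all pairs
    of a basic set and a level.\<close>
  define I where "I = {(U, b). U \<in> \<B> \<and> b \<in> \<rat> \<and> U \<inter> S \<noteq> {} \<and> expect M zt (H U) < b}"
  have "I \<subseteq> \<B> \<times> \<rat>" by (auto simp: I_def)
  then have "countable I"
    using \<B>(1) countable_rat by (metis countable_SIGMA countable_subset)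
  moreover have "AE \<omega> in M. eventually (\<lambda>n. sample_avg n z \<omega> (H (fst i)) < snd i) sequentially"
    if "i \<in> I" for i
  proof (rule AE_eventually_sample_avg_less[OF zt iid])
    have "open (fst i)" "fst i \<inter> S \<noteq> {}"
      using that topological_basis_open[OF \<B>(2)] by (auto simp: I_def)
    then show "finite_expect M zt \<Xi> (H (fst i))" by (rule H_finite)
    show "expect M zt (H (fst i)) < snd i" using that by (auto simp: I_def)
  qed
  ultimately have "AE \<omega> in M. \<forall>i\<in>I. eventually (\<lambda>n. sample_avg n z \<omega> (H (fst i)) < snd i) sequentially"
    by (simp add: AE_ball_countable)
  then show ?thesis
  proof (rule AE_mp, intro AE_I2 impI ballI allI)
    fix \<omega> p b
    assume \<omega>: "\<omega> \<in> space M"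
      and lln: "\<forall>i\<in>I. eventually (\<lambda>n. sample_avg n z \<omega> (H (fst i)) < snd i) sequentially"
      and p: "p \<in> S" and b: "expect M zt (h p) < b"
    obtain V where V: "open V" "p \<in> V" "expect M zt (H V) < b"
      using small_nbhd[OF p b] by blast
    obtain U where U: "U \<in> \<B>" "p \<in> U" "U \<subseteq> V"
      using topological_basisE[OF \<B>(2) V(1,2)] by blast
    have U_open: "open U" using topological_basis_open[OF \<B>(2)] U by blast
    \<comment> \<open>\<open>V\<close> need not be basic; shrinking it to a basic \<open>U\<close>
      can only lower the mean of the supremum.\<close>
    have "expect M zt (H U) \<le> expect M zt (H V)"
    proof (rule integral_mono)
      show "integrable M (\<lambda>\<omega>. H U (zt \<omega>))" "integrable M (\<lambda>\<omega>. H V (zt \<omega>))"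
        using H_finite[OF U_open] H_finite[OF V(1)] p U V by (auto dest: finite_expectD(2))
      fix \<omega>' assume "\<omega>' \<in> space M"
      then show "H U (zt \<omega>') \<le> H V (zt \<omega>')"
        unfolding H_def using p U zt(2) by (intro cSUP_subset_mono bdd) auto
    qed
    then obtain r where r: "r \<in> \<rat>" "expect M zt (H U) < r" "r < b"
      using V(3) Rats_dense_in_real[of "expect M zt (H U)" b] by auto
    then have "(U, r) \<in> I" using U p by (auto simp: I_def)
    then have "eventually (\<lambda>n. sample_avg n z \<omega> (H U) < r) sequentially" using lln by force
    then have "eventually (\<lambda>n. \<forall>q\<in>U \<inter> S. sample_avg n z \<omega> (h q) < b) sequentially"
    proof eventually_elim
      case (elim n)
      have "sample_avg n z \<omega> (h q) \<le> sample_avg n z \<omega> (H U)" if "q \<in> U \<inter> S" for q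
        unfolding sample_avg_def using that H_ge \<omega> iid
        by (intro divide_right_mono sum_mono) (auto simp: iid_samples_def)
      with elim r(3) show ?case by force
    qed
    with U(2) U_open show "\<exists>U. open U \<and> p \<in> U \<and>
        eventually (\<lambda>n. \<forall>q\<in>U \<inter> S. sample_avg n z \<omega> (h q) < b) sequentially" by blast
  qed
qed

end

section \<open>Limits of penalized minimizers\<close>

text \<open>
  No measurability is required of the selections \<open>s\<close>, so a violating \<open>t\<close> can be picked for each
  \<open>\<omega>\<close> separately; this merges uncountably many exceptional null sets into one.
\<close>

lemma AE_all_selections:
  assumes ex: "\<And>\<omega>. \<omega> \<in> space M \<Longrightarrow> \<exists>t. V \<omega> t"
    and sel: "\<And>s. (\<And>\<omega>. \<omega> \<in> space M \<Longrightarrow> V \<omega> (s \<omega>)) \<Longrightarrow> AE \<omega> in M. Q \<omega> (s \<omega>)"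
  shows "AE \<omega> in M. \<forall>t. V \<omega> t \<longrightarrow> Q \<omega> t"
proof -
  \<comment> \<open>The second branch keeps the selection admissible where no violation exists,
    since \<open>sel\<close> needs \<open>V\<close> at every point of the space.\<close>
  define s where "s \<omega> = (if \<exists>t. V \<omega> t \<and> \<not> Q \<omega> t then SOME t. V \<omega> t \<and> \<not> Q \<omega> t else SOME t. V \<omega> t)" for \<omega>
  have bad: "V \<omega> (s \<omega>) \<and> \<not> Q \<omega> (s \<omega>)" if "\<exists>t. V \<omega> t \<and> \<not> Q \<omega> t" for \<omega>
    using someI_ex[OF that] that by (simp add: s_def)
  have "V \<omega> (s \<omega>)" if "\<omega> \<in> space M" for \<omega>
  proof (cases "\<exists>t. V \<omega> t \<and> \<not> Q \<omega> t")
    case False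
    then show ?thesis using someI_ex[OF ex[OF that]] unfolding s_def by (simp only: if_False)
  qed (use bad in blast)
  then have "AE \<omega> in M. Q \<omega> (s \<omega>)" by (rule sel)
  then show ?thesis
    by eventually_elim (use bad in blast)
qed

text \<open>The limit hypotheses speak of sequences over all indices, while convergence is known
  only along \<open>r\<close>. Filling the gaps with the limit itself reconciles the two.\<close>

lemma tendsto_range_subseq:
  fixes f :: "nat \<Rightarrow> 'a::topological_space"
  assumes "strict_mono r" and lim: "(\<lambda>i. f (r i)) \<longlonglongrightarrow> l"
  shows "(\<lambda>n. if n \<in> range r then f n else l) \<longlonglongrightarrow> l"
proof (rule topological_tendstoI)
  fix S assume S: "open S" "l \<in> S"
  then obtain i0 where i0: "\<And>i. i \<ge> i0 \<Longrightarrow> f (r i) \<in> S"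
    using topological_tendstoD[OF lim] by (auto simp: eventually_sequentially)
  have "(if n \<in> range r then f n else l) \<in> S" if "n \<ge> r i0" for n
    using that i0 S(2) strict_mono_less_eq[OF assms(1)] by auto
  then show "eventually (\<lambda>n. (if n \<in> range r then f n else l) \<in> S) sequentially"
    unfolding eventually_sequentially by blast
qed

lemma filterlim_along:
  assumes "strict_mono r" "range r \<subseteq> \<kappa>"
  shows "filterlim r (along \<kappa>) sequentially"
  using assms by (auto simp: filterlim_inf filterlim_principal intro!: filterlim_subseq always_eventually)

text \<open>Along a tangent sequence, local Lipschitz continuity lets \<open>y i\<close> be replaced
  by \<open>x + t i *\<^sub>R v\<close> with an error of smaller order than \<open>t i\<close>, and
  the proximal term is quadratic in the distance from \<open>x\<close>. Minimality then bounds the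
  difference quotients below by a null sequence.\<close>

lemma B_stationary_proximal_minimizer:
  fixes f :: "'a::real_normed_vector \<Rightarrow> real"
  assumes x: "x \<in> C" and f: "B_differentiable f x"
    and min: "\<And>y. y \<in> C \<Longrightarrow> f x \<le> f y + r * (norm (y - x))\<^sup>2"
  shows "B_stationary (\<lambda>y. f y + r * (norm (y - x))\<^sup>2) C x"
  unfolding B_stationary_def
proof (intro conjI ballI x)
  fix v assume "v \<in> bouligand_tangent_cone C x"
  then obtain y t where yt': "\<forall>i::nat. y i \<in> C \<and> 0 < t i" "y \<longlonglongrightarrow> x" "t \<longlonglongrightarrow> 0"
      "(\<lambda>i. (y i - x) /\<^sub>R t i) \<longlonglongrightarrow> v"
    unfolding bouligand_tangent_cone_def by blast
  then have yt: "\<And>i. y i \<in> C" "\<And>i. 0 < t i" "y \<longlonglongrightarrow> x" "t \<longlonglongrightarrow> 0"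
    "(\<lambda>i. (y i - x) /\<^sub>R t i) \<longlonglongrightarrow> v" by auto
  obtain e B where e: "e > 0" "B-lipschitz_on (ball x e) f" and dir: "dir_differentiable f x"
    using f by (auto simp: B_differentiable_def)
  obtain D where D: "((\<lambda>s. (f (x + s *\<^sub>R v) - f x) / s) \<longlongrightarrow> D) (at_right 0)"
    using dir by (auto simp: dir_differentiable_def has_dir_deriv_def)
  \<comment> \<open>The quadratic adds \<open>r * (s * (norm v)\<^sup>2)\<close> to the quotient, so
    the proximal objective inherits the directional derivative of \<open>f\<close>.\<close>
  have "((\<lambda>s. (f (x + s *\<^sub>R v) - f x) / s + r * (s * (norm v)\<^sup>2)) \<longlongrightarrow> D + r * (0 * (norm v)\<^sup>2)) (at_right 0)"
    by (intro tendsto_intros D)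
  moreover have "eventually (\<lambda>s. (f (x + s *\<^sub>R v) - f x) / s + r * (s * (norm v)\<^sup>2) =
      (f (x + s *\<^sub>R v) + r * (norm (x + s *\<^sub>R v - x))\<^sup>2 - (f x + r * (norm (x - x))\<^sup>2)) / s) (at_right 0)"
    using eventually_at_right_less[of 0]
    by eventually_elim (simp add: field_simps power2_eq_square)
  ultimately have D': "has_dir_deriv (\<lambda>y. f y + r * (norm (y - x))\<^sup>2) x v D"
    unfolding has_dir_deriv_def by (simp add: tendsto_cong)
  have t_lim: "filterlim t (at_right 0) sequentially"
    using yt(2,4) by (auto simp: filterlim_at less_imp_neq[symmetric] intro!: always_eventually)
  have q_lim: "(\<lambda>i. (f (x + t i *\<^sub>R v) - f x) / t i) \<longlonglongrightarrow> D"
    by (rule filterlim_compose[OF D t_lim])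
  let ?w = "\<lambda>i. (y i - x) /\<^sub>R t i"
  \<comment> \<open>The first term is the Lipschitz cost of moving from \<open>y i\<close> to the
    ray, the second the proximal term, both divided by \<open>t i\<close>; the absolute value covers
    either sign of \<open>r\<close>.\<close>
  let ?err = "\<lambda>i. B * norm (?w i - v) + \<bar>r\<bar> * (norm (?w i) * norm (y i - x))"
  have "?err \<longlonglongrightarrow> B * norm (v - v) + \<bar>r\<bar> * (norm v * norm (x - x))"
    by (intro tendsto_intros yt)
  then have err: "?err \<longlonglongrightarrow> 0" by simp
  have "(\<lambda>i. x + t i *\<^sub>R v) \<longlonglongrightarrow> x + 0 *\<^sub>R v" by (intro tendsto_intros yt)
  then have "eventually (\<lambda>i. x + t i *\<^sub>R v \<in> ball x e) sequentially"
    using e(1) by (intro topological_tendstoD) auto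
  moreover have "eventually (\<lambda>i. y i \<in> ball x e) sequentially"
    using e(1) by (intro topological_tendstoD[OF yt(3)]) auto
  ultimately have "eventually (\<lambda>i. - ?err i \<le> (f (x + t i *\<^sub>R v) - f x) / t i) sequentially"
  proof eventually_elim
    case (elim i)
    have t: "t i > 0" by (rule yt)
    have "y i - (x + t i *\<^sub>R v) = t i *\<^sub>R (?w i - v)"
      using t by (simp add: algebra_simps)
    then have "norm (y i - (x + t i *\<^sub>R v)) = t i * norm (?w i - v)"
      using t by simp
    moreover have "f (y i) - f (x + t i *\<^sub>R v) \<le> B * norm (y i - (x + t i *\<^sub>R v))"
      using lipschitz_onD[OF e(2) elim(2,1)] by (simp add: dist_norm)
    moreover have "r * (norm (y i - x))\<^sup>2 \<le> \<bar>r\<bar> * ((t i * norm (?w i)) * norm (y i - x))"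
    proof -
      have "t i * norm (?w i) = norm (y i - x)" using t by simp
      then show ?thesis by (simp only: power2_eq_square) (simp add: mult_right_mono)
    qed
    ultimately have "- (t i * ?err i) \<le> f (x + t i *\<^sub>R v) - f x"
      using min[OF yt(1)[of i]] by (simp add: algebra_simps)
    then show ?case using t by (simp add: field_simps)
  qed
  then have "- 0 \<le> D" using q_lim tendsto_minus[OF err] by (intro tendsto_le[of sequentially]) auto
  with D' show "\<exists>D. has_dir_deriv (\<lambda>y. f y + r * (norm (y - x))\<^sup>2) x v D \<and> 0 \<le> D" by auto
qed

lemma B_differentiable_imp_isCont: "B_differentiable f x \<Longrightarrow> isCont f x"
  unfolding B_differentiable_def
  by (metis lipschitz_on_continuous_on centre_in_ball continuous_on_eq_continuous_at open_ball)

text \<open>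
  The index \<open>i\<close> runs through a convergent subsequence of the iterates: \<open>xs i\<close> is the iterate and
  \<open>xp i\<close> its successor, \<open>H i\<close> and \<open>G i k\<close> are the sample averages of the surrogates at \<open>xs i\<close>, and
  \<open>a\<close> is \<open>1 / \<lambda>\<^sub>\<infinity>\<close>.
\<close>

locale penalty_minimizers =
  fixes X :: "'a::real_normed_vector set" and K :: nat and \<zeta> :: "nat \<Rightarrow> real"
    and H :: "nat \<Rightarrow> 'a \<Rightarrow> real" and G :: "nat \<Rightarrow> nat \<Rightarrow> 'a \<Rightarrow> real"
    and lam rho :: "nat \<Rightarrow> real" and xs xp :: "nat \<Rightarrow> 'a"
    and x :: 'a and obj :: "'a \<Rightarrow> real" and con :: "nat \<Rightarrow> 'a \<Rightarrow> real" and a rho_lim :: real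
  assumes min: "\<And>i y. y \<in> X \<Longrightarrow>
      H i (xp i) + lam i * (\<Sum>k=1..K. max (G i k (xp i) - \<zeta> k) 0) + rho i / 2 * (norm (xp i - xs i))\<^sup>2
        \<le> H i y + lam i * (\<Sum>k=1..K. max (G i k y - \<zeta> k) 0) + rho i / 2 * (norm (y - xs i))\<^sup>2"
    and H_lower: "\<And>e. 0 < e \<Longrightarrow> eventually (\<lambda>i. obj x - e < H i (xp i)) sequentially"
    and H_upper: "\<And>y e. y \<in> X \<Longrightarrow> 0 < e \<Longrightarrow> eventually (\<lambda>i. H i y < obj y + e) sequentially"
    and G_lower: "\<And>k e. k \<in> {1..K} \<Longrightarrow> 0 < e \<Longrightarrow> eventually (\<lambda>i. con k x - e < G i k (xp i)) sequentially"
    and G_upper: "\<And>k y e. k \<in> {1..K} \<Longrightarrow> y \<in> X \<Longrightarrow> 0 < e \<Longrightarrow> eventually (\<lambda>i. G i k y < con k y + e) sequentially"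
    and lam_pos: "\<And>i. 0 < lam i" and rho_pos: "\<And>i. 0 < rho i"
    and lam_lim: "(\<lambda>i. 1 / lam i) \<longlonglongrightarrow> a"
    and ratio_lim: "(\<lambda>i. rho i / lam i) \<longlonglongrightarrow> 0" and rho_lim: "rho \<longlonglongrightarrow> rho_lim"
    and xs_lim: "xs \<longlonglongrightarrow> x"
begin

text \<open>Divide the comparison of \<open>xp i\<close> with \<open>y\<close> by
  \<open>lam i\<close>. The proximal term disappears since \<open>rho i / lam i\<close> tends to 0,
  the scaled penalty of \<open>y\<close> becomes arbitrarily small, and the scaled objective gap
  tends to \<open>a * (obj y - obj x)\<close>, which is at most 0. What remains bounds the violation
  at \<open>x\<close>.\<close>

lemma feasible_limit:
  assumes y: "y \<in> X" "\<And>k. k \<in> {1..K} \<Longrightarrow> con k y \<le> \<zeta> k" and obj: "a * obj y \<le> a * obj x"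
    and k: "k \<in> {1..K}"
  shows "con k x \<le> \<zeta> k"
proof (rule field_le_epsilon)
  fix e :: real assume e: "0 < e"
  have a: "0 \<le> a"
    using lam_pos by (intro LIMSEQ_le_const[OF lam_lim]) (auto simp: less_imp_le)
  \<comment> \<open>The slack is budgeted to total \<open>e\<close>: one \<open>d\<close> for the
    constraint at \<open>x\<close>, \<open>K\<close> of them for the penalties at \<open>y\<close>,
    and \<open>2 * d\<close> for the two objective estimates, weighted by \<open>a\<close>.\<close>
  define d where "d = e / (1 + real K + 2 * a)"
  have d: "0 < d" "d * (1 + real K) + 2 * (a * d) = e"
  proof -
    have "0 < 1 + real K + 2 * a" using a by simp
    then show "0 < d" "d * (1 + real K) + 2 * (a * d) = e"
      using e by (simp_all add: d_def divide_simps) (simp add: algebra_simps)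
  qed
  let ?u = "\<lambda>i. 1 / lam i * (obj y - obj x + 2 * d) + rho i / lam i / 2 * (norm (y - xs i))\<^sup>2"
  have "?u \<longlonglongrightarrow> a * (obj y - obj x + 2 * d) + 0 / 2 * (norm (y - x))\<^sup>2"
    by (intro tendsto_intros lam_lim ratio_lim xs_lim) simp
  moreover have "eventually (\<lambda>i. con k x - \<zeta> k - d * (1 + K) \<le> ?u i) sequentially"
  proof -
    have "eventually (\<lambda>i. \<forall>j\<in>{1..K}. G i j y < con j y + d) sequentially"
      using G_upper y(1) d(1) by (intro eventually_ball_finite) auto
    with H_lower[OF d(1)] H_upper[OF y(1) d(1)] G_lower[OF k d(1)]
    show ?thesis
    proof eventually_elim
      case (elim i)
      have l: "lam i > 0" "rho i > 0" by (rule lam_pos rho_pos)+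
      have "(\<Sum>j=1..K. max (G i j y - \<zeta> j) 0) \<le> (\<Sum>j=1..K. d)"
        using elim(4) y(2) d(1) by (intro sum_mono) force
      then have 1: "lam i * (\<Sum>j=1..K. max (G i j y - \<zeta> j) 0) \<le> lam i * (d * K)"
        using l by (intro mult_left_mono) (auto simp: mult.commute)
      have "con k x - d - \<zeta> k \<le> max (G i k (xp i) - \<zeta> k) 0" using elim(3) by linarith
      also have "\<dots> \<le> (\<Sum>j=1..K. max (G i j (xp i) - \<zeta> j) 0)"
        using k by (intro member_le_sum) auto
      finally have 2: "lam i * (con k x - d - \<zeta> k) \<le> lam i * (\<Sum>j=1..K. max (G i j (xp i) - \<zeta> j) 0)"
        using l by (intro mult_left_mono) auto
      have 3: "0 \<le> rho i / 2 * (norm (xp i - xs i))\<^sup>2" using l by simp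
      have "lam i * (con k x - d - \<zeta> k) \<le> lam i * (d * K) + (obj y - obj x + 2 * d) + rho i / 2 * (norm (y - xs i))\<^sup>2"
        using min[OF y(1), of i] 1 2 3 elim(1,2) by linarith
      then have "lam i * (con k x - \<zeta> k - d * (1 + K)) \<le> (obj y - obj x + 2 * d) + rho i / 2 * (norm (y - xs i))\<^sup>2"
        by (simp add: algebra_simps)
      then have "(lam i * (con k x - \<zeta> k - d * (1 + K))) / lam i
          \<le> ((obj y - obj x + 2 * d) + rho i / 2 * (norm (y - xs i))\<^sup>2) / lam i"
        using l by (intro divide_right_mono) auto
      then show ?case using l by (simp add: add_divide_distrib)
    qed
  qed
  ultimately have "con k x - \<zeta> k - d * (1 + K) \<le> a * (obj y - obj x + 2 * d) + 0 / 2 * (norm (y - x))\<^sup>2"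
    by (intro tendsto_lowerbound[of ?u _ sequentially]) auto
  also have "\<dots> \<le> 2 * (a * d)" using obj by (simp add: algebra_simps)
  finally show "con k x \<le> \<zeta> k + e" using d(2) by simp
qed

text \<open>As \<open>lam i\<close> may be unbounded, no penalty of \<open>y\<close> may survive:
  with the slack \<open>\<zeta> k - con k y\<close> as tolerance, strict feasibility makes it
  exactly 0 for large \<open>i\<close>. The penalty of \<open>xp i\<close> is dropped by
  sign.\<close>

lemma minimal_limit:
  assumes y: "y \<in> X" "\<And>k. k \<in> {1..K} \<Longrightarrow> con k y < \<zeta> k"
  shows "obj x \<le> obj y + rho_lim / 2 * (norm (y - x))\<^sup>2"
proof (rule field_le_epsilon)
  fix e :: real assume e: "0 < e"
  have "eventually (\<lambda>i. \<forall>k\<in>{1..K}. G i k y < con k y + (\<zeta> k - con k y)) sequentially"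
    using y by (intro eventually_ball_finite ballI G_upper) auto
  moreover have "0 < e / 2" using e by simp
  note H_lower[OF this] H_upper[OF y(1) this]
  ultimately have "eventually (\<lambda>i. obj x \<le> obj y + e + rho i / 2 * (norm (y - xs i))\<^sup>2) sequentially"
  proof eventually_elim
    case (elim i)
    have "(\<Sum>k=1..K. max (G i k y - \<zeta> k) 0) = (\<Sum>k=1..K. 0)"
      using elim(1) by (intro sum.cong) auto
    moreover have "0 \<le> lam i * (\<Sum>k=1..K. max (G i k (xp i) - \<zeta> k) 0)"
      using lam_pos[of i] by (intro mult_nonneg_nonneg sum_nonneg) auto
    moreover have "0 \<le> rho i / 2 * (norm (xp i - xs i))\<^sup>2" using rho_pos[of i] by simp
    ultimately show ?case using min[OF y(1), of i] elim(2,3) by simp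
  qed
  moreover have "(\<lambda>i. obj y + e + rho i / 2 * (norm (y - xs i))\<^sup>2) \<longlonglongrightarrow> obj y + e + rho_lim / 2 * (norm (y - x))\<^sup>2"
    by (intro tendsto_intros rho_lim xs_lim) simp
  ultimately have "obj x \<le> obj y + e + rho_lim / 2 * (norm (y - x))\<^sup>2"
    by (intro tendsto_lowerbound[of _ _ sequentially]) auto
  then show "obj x \<le> obj y + rho_lim / 2 * (norm (y - x))\<^sup>2 + e" by simp
qed

end

section \<open>Stationarity of accumulation points\<close>

lemma usc_on_continuous_on: "continuous_on S f \<Longrightarrow> usc_on S f"
  unfolding usc_on_def by (auto simp: continuous_on_def intro: order_tendstoD)

text \<open>By continuity in \<open>p\<close>, a strict inequality at a point of
  \<open>U \<inter> S\<close> already holds at a point of a countable dense subset, so the set is a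
  countable union.\<close>

lemma sets_exists_less_continuous_integrand:
  fixes h :: "'b::{metric_space, second_countable_topology} \<Rightarrow> 'z \<Rightarrow> real"
  assumes U: "open U" and h: "\<And>p. p \<in> S \<Longrightarrow> h p \<in> borel_measurable R"
    and cont: "\<And>\<xi>. \<xi> \<in> space R \<Longrightarrow> continuous_on S (\<lambda>p. h p \<xi>)"
  shows "{\<xi>\<in>space R. \<exists>p\<in>U \<inter> S. a < h p \<xi>} \<in> sets R"
proof -
  obtain T where T: "countable T" "T \<subseteq> U \<inter> S" "U \<inter> S \<subseteq> closure T"
    using separable by blast
  have "\<exists>p\<in>T. a < h p \<xi>" if \<xi>: "\<xi> \<in> space R" and p: "p \<in> U \<inter> S" "a < h p \<xi>" for \<xi> p
  proof -
    obtain q where q: "\<And>n::nat. q n \<in> T" "q \<longlonglongrightarrow> p"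
      using T(3) p(1) closure_sequential[of p T] by blast
    have "((\<lambda>p. h p \<xi>) \<circ> q) \<longlonglongrightarrow> h p \<xi>"
      using cont[OF \<xi>] p(1) q T(2) unfolding continuous_on_sequentially by blast
    then have "eventually (\<lambda>n. a < h (q n) \<xi>) sequentially"
      using p(2) by (auto dest: order_tendstoD)
    then show ?thesis using q(1) by (auto simp: eventually_sequentially)
  qed
  then have "{\<xi>\<in>space R. \<exists>p\<in>U \<inter> S. a < h p \<xi>} = (\<Union>p\<in>T. {\<xi>\<in>space R. a < h p \<xi>})"
    using T(2) by blast
  also have "\<dots> \<in> sets R"
  proof (rule sets.countable_UN''[OF T(1)])
    fix p assume "p \<in> T"
    then have [measurable]: "h p \<in> borel_measurable R" using T(2) h by blast
    show "{\<xi>\<in>space R. a < h p \<xi>} \<in> sets R" by measurable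
  qed
  finally show ?thesis .
qed

text \<open>Makes finite and infinite limits look alike: \<open>a\<close> is real in both cases, and
  0 for an infinite limit. The lower bound 1 keeps the limit away from 0.\<close>

lemma ereal_limit_reciprocal:
  fixes l :: "nat \<Rightarrow> real"
  assumes lim: "(\<lambda>i. ereal (l i)) \<longlonglongrightarrow> L" and ge: "eventually (\<lambda>i. 1 \<le> l i) sequentially"
  obtains a where "(\<lambda>i. 1 / l i) \<longlonglongrightarrow> a" "1 / L = ereal a"
proof -
  have L: "1 \<le> L"
    using ge by (intro tendsto_lowerbound[OF lim]) (auto elim: eventually_mono simp: one_ereal_def)
  show ?thesis
  proof (cases L)
    case (real r)
    with L have "1 \<le> r" by (simp add: one_ereal_def)
    moreover have "l \<longlonglongrightarrow> r" using lim real by simp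
    ultimately have "(\<lambda>i. 1 / l i) \<longlonglongrightarrow> 1 / r" by (intro tendsto_intros) auto
    with that real \<open>1 \<le> r\<close> show ?thesis by (simp add: one_ereal_def)
  next
    case PInf
    then have "filterlim l at_top sequentially" using lim by (simp add: tendsto_PInfty_eq_at_top)
    then have "(\<lambda>i. 1 / l i) \<longlonglongrightarrow> 0"
      using tendsto_inverse_0_at_top by (simp add: inverse_eq_divide)
    with that PInf show ?thesis by (simp add: zero_ereal_def)
  qed (use L in simp)
qed

theorem theorem25:
  fixes M :: "'w measure"
    and zt :: "'w \<Rightarrow> real^'d"
    and \<Xi> :: "(real^'d) set"
    and \<O> X :: "(real^'n) set"
    and K L :: nat
    and c0 :: "real^'n \<Rightarrow> real^'d \<Rightarrow> real"
    and c :: "nat \<Rightarrow> nat \<Rightarrow> real^'n \<Rightarrow> real^'d \<Rightarrow> real \<Rightarrow> real"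
    and hc0 :: "real^'n \<Rightarrow> real^'d \<Rightarrow> real^'n \<Rightarrow> real"
    and hc :: "nat \<Rightarrow> real^'n \<Rightarrow> real^'d \<Rightarrow> real \<Rightarrow> real^'n \<Rightarrow> real"
    and ct :: "nat \<Rightarrow> real^'n \<Rightarrow> real^'d \<Rightarrow> real^'n \<Rightarrow> real"
    and \<zeta> lam rho gam :: "nat \<Rightarrow> real"
    and lam_inf :: ereal
    and rho_inf :: real
    and N :: "nat \<Rightarrow> nat"
    and z :: "nat \<Rightarrow> 'w \<Rightarrow> real^'d"
    and x :: "nat \<Rightarrow> 'w \<Rightarrow> real^'n"
    and x_inf :: "'w \<Rightarrow> real^'n"
    and \<kappa> :: "nat set"
  assumes "spsa_problem M zt \<Xi> \<O> X K L c0 c hc0 hc"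
    and "regular_surrogate M zt \<Xi> \<O> X hc0"
    and "spsa_parameters X K (mean_constr M zt L c) N lam lam_inf rho rho_inf gam"
    and "gam \<longlonglongrightarrow> 0"
    and "iid_samples M zt \<Xi> z"
    and "spsa_iterates M X K \<zeta> hc0 hc N lam rho gam z x"
    and "\<kappa> \<subseteq> {1..}" and "infinite \<kappa>"
    and "AE \<omega> in M. ((\<lambda>\<nu>. norm (x (\<nu> + 1) \<omega> - x \<nu> \<omega>)) \<longlongrightarrow> 0) (along \<kappa>)"
    and "AE \<omega> in M. acc_point_along \<kappa> (\<lambda>\<nu>. x \<nu> \<omega>) (x_inf \<omega>)"
    and "AE \<omega> in M. \<forall>k\<in>{1..K}. \<forall>y\<in>X. finite_expect M zt \<Xi> (\<lambda>\<xi>. ct k y \<xi> (x_inf \<omega>))"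
    and "\<And>z' y u k. iid_samples M zt \<Xi> z' \<Longrightarrow> k \<in> {1..K} \<Longrightarrow>
           \<forall>\<nu>. \<forall>\<omega>\<in>space M. (y \<nu> \<omega>, u \<nu> \<omega>) \<in> X \<times> X \<Longrightarrow>
           AE \<omega> in M. (\<lambda>\<nu>. (y \<nu> \<omega>, u \<nu> \<omega>)) \<longlonglongrightarrow> (x_inf \<omega>, x_inf \<omega>) \<Longrightarrow>
           AE \<omega> in M. ereal (expect M zt (\<lambda>\<xi>. ct k (x_inf \<omega>) \<xi> (x_inf \<omega>)))
             \<le> Liminf (along \<kappa>)
                 (\<lambda>\<nu>. ereal (sample_avg (N \<nu>) z' \<omega> (\<lambda>\<xi>. hc k (y \<nu> \<omega>) \<xi> (gam \<nu>) (u \<nu> \<omega>))))"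
    and "\<And>z' y u y_inf k. iid_samples M zt \<Xi> z' \<Longrightarrow> k \<in> {1..K} \<Longrightarrow>
           \<forall>\<nu>. \<forall>\<omega>\<in>space M. (y \<nu> \<omega>, u \<nu> \<omega>) \<in> X \<times> X \<Longrightarrow>
           \<forall>\<omega>\<in>space M. y_inf \<omega> \<in> X \<Longrightarrow>
           AE \<omega> in M. (\<lambda>\<nu>. (y \<nu> \<omega>, u \<nu> \<omega>)) \<longlonglongrightarrow> (y_inf \<omega>, x_inf \<omega>) \<Longrightarrow>
           AE \<omega> in M. Limsup (along \<kappa>)
                 (\<lambda>\<nu>. ereal (sample_avg (N \<nu>) z' \<omega> (\<lambda>\<xi>. hc k (y \<nu> \<omega>) \<xi> (gam \<nu>) (u \<nu> \<omega>))))
             \<le> ereal (expect M zt (\<lambda>\<xi>. ct k (y_inf \<omega>) \<xi> (x_inf \<omega>)))"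
  shows "AE \<omega> in M.
    (let obj = (\<lambda>y. expect M zt (\<lambda>\<xi>. hc0 y \<xi> (x_inf \<omega>)));
         con = (\<lambda>k y. expect M zt (\<lambda>\<xi>. ct k y \<xi> (x_inf \<omega>)));
         xhat_exists = (\<exists>xh\<in>X. (\<forall>k\<in>{1..K}. con k xh \<le> \<zeta> k) \<and>
            1 / lam_inf * ereal (obj xh) \<le> 1 / lam_inf * ereal (obj (x_inf \<omega>)));
         feasible = {y\<in>X. \<forall>k\<in>{1..K}. con k y \<le> \<zeta> k};
         strictly_feasible = {y\<in>X. \<forall>k\<in>{1..K}. con k y < \<zeta> k}
     in (xhat_exists \<longrightarrow> (\<forall>k\<in>{1..K}. con k (x_inf \<omega>) \<le> \<zeta> k)) \<and>
        (xhat_exists \<and> feasible \<noteq> {} \<and> feasible \<subseteq> closure strictly_feasible \<longrightarrow>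
           B_stationary (\<lambda>y. obj y + rho_inf / 2 * (norm (y - x_inf \<omega>))\<^sup>2) feasible (x_inf \<omega>)))"
proof -

  \<comment> \<open>Facts about the iterates and the surrogate of the objective\<close>
  interpret P: spsa_problem M zt \<Xi> \<O> X K L c0 c hc0 hc by (rule assms(1))
  let ?R = "restrict_space borel \<Xi>"
  have closed_X: "closed X" using P.polytope_X by (rule polytope_imp_closed)
  have z_in: "z s \<omega> \<in> \<Xi>" if "s \<ge> 1" "\<omega> \<in> space M" for s \<omega>
    using assms(5) that by (auto simp: iid_samples_def)
  have x_in: "x \<nu> \<omega> \<in> X" if "\<nu> \<ge> 1" "\<omega> \<in> space M" for \<nu> \<omega>
    using that(1)
  proof (cases \<nu> rule: nat.exhaust)
    case (Suc \<mu>)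
    then show ?thesis using assms(6) that
      by (cases "\<mu> = 0") (auto simp: spsa_iterates_def is_arg_min_def)
  qed simp
  have sur: "c0 y \<xi> \<le> hc0 y \<xi> u" "hc0 u \<xi> u = c0 u \<xi>"
    "usc_on (X \<times> X) (\<lambda>p. hc0 (fst p) \<xi> (snd p))"
    if "\<xi> \<in> \<Xi>" "y \<in> X" "u \<in> X" for \<xi> y u
    using P.surrogate_obj that by (auto simp: is_surrogate_def case_prod_unfold)
  have reg: "\<And>u y. u \<in> X \<Longrightarrow> y \<in> \<O> \<Longrightarrow> finite_expect M zt \<Xi> (\<lambda>\<xi>. hc0 y \<xi> u)"
    "\<And>u y. u \<in> X \<Longrightarrow> y \<in> X \<Longrightarrow> B_differentiable (\<lambda>y. expect M zt (\<lambda>\<xi>. hc0 y \<xi> u)) y"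
    "\<And>U a. open U \<Longrightarrow> {\<xi>\<in>\<Xi>. \<exists>p\<in>U \<inter> X \<times> X. a < hc0 (fst p) \<xi> (snd p)} \<in> sets ?R"
    using assms(2) by (auto simp: regular_surrogate_def case_prod_unfold)
  obtain g where g: "finite_expect M zt \<Xi> g" "\<And>\<xi> y u. \<xi> \<in> \<Xi> \<Longrightarrow> y \<in> X \<Longrightarrow> u \<in> X \<Longrightarrow> hc0 y \<xi> u \<le> g \<xi>"
  proof -
    have "\<exists>g. finite_expect M zt \<Xi> g \<and> (\<forall>\<xi>\<in>\<Xi>. \<forall>y\<in>X. \<forall>u\<in>X. hc0 y \<xi> u \<le> g \<xi>)"
      using assms(2) by (simp add: regular_surrogate_def)
    then show ?thesis using that by blast
  qed
  have X_O: "y \<in> \<O>" if "y \<in> X" for y using P.open_dom that by blast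

  \<comment> \<open>Uniform laws of large numbers for the objective\<close>
  have hc0_lln: "AE \<omega> in M. \<forall>p\<in>X \<times> X. \<forall>b>expect M zt (\<lambda>\<xi>. hc0 (fst p) \<xi> (snd p)).
      \<exists>U. open U \<and> p \<in> U \<and> eventually (\<lambda>n. \<forall>q\<in>U \<inter> X \<times> X.
        sample_avg n z \<omega> (\<lambda>\<xi>. hc0 (fst q) \<xi> (snd q)) < b) sequentially"
  proof (rule P.AE_sample_avg_usc_integrand[OF P.random_zt assms(5) _ g(1)])
    show "finite_expect M zt \<Xi> (\<lambda>\<xi>. hc0 (fst p) \<xi> (snd p))" if "p \<in> X \<times> X" for p
      by (rule reg(1)) (use that X_O in auto)
    show "usc_on (X \<times> X) (\<lambda>p. hc0 (fst p) \<xi> (snd p))" if "\<xi> \<in> \<Xi>" for \<xi>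
    proof (cases "X = {}")
      case False
      then show ?thesis using sur(3)[OF that] by blast
    qed (simp add: usc_on_def)
  qed (auto intro: g(2) reg(3))
  have c0_cont: "continuous_on X (\<lambda>y. c0 y \<xi>)" if "\<xi> \<in> \<Xi>" for \<xi>
    using P.c0_lipschitz that P.open_dom(2)
    by (meson continuous_on_subset lipschitz_on_continuous_on)
  have c0_meas: "c0 y \<in> borel_measurable ?R" if "y \<in> X" for y
    using finite_expectD(1)[OF P.c0_expect[OF X_O[OF that]]] by simp
  \<comment> \<open>A lower bound for averages of \<open>c0\<close> is an upper bound for averages
    of its negative, and nonnegativity of \<open>c0\<close> provides the majorant 0.\<close>
  have c0_lln: "AE \<omega> in M. \<forall>p\<in>X. \<forall>b>expect M zt (\<lambda>\<xi>. - c0 p \<xi>).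
      \<exists>U. open U \<and> p \<in> U \<and> eventually (\<lambda>n. \<forall>q\<in>U \<inter> X. sample_avg n z \<omega> (\<lambda>\<xi>. - c0 q \<xi>) < b) sequentially"
  proof (rule P.AE_sample_avg_usc_integrand[OF P.random_zt assms(5)])
    show "finite_expect M zt \<Xi> (\<lambda>\<xi>. - c0 p \<xi>)" if "p \<in> X" for p
      using P.c0_expect[OF X_O[OF that]] by (auto simp: finite_expect_def)
    show "finite_expect M zt \<Xi> (\<lambda>_. 0)" by (simp add: finite_expect_def)
    show "- c0 p \<xi> \<le> 0" if "p \<in> X" "\<xi> \<in> \<Xi>" for p \<xi> using P.c0_nonneg that by simp
    show "usc_on X (\<lambda>p. - c0 p \<xi>)" if "\<xi> \<in> \<Xi>" for \<xi>
      by (intro usc_on_continuous_on continuous_on_minus c0_cont that)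
    show "{\<xi>\<in>\<Xi>. \<exists>p\<in>U \<inter> X. a < - c0 p \<xi>} \<in> sets ?R" if "open U" for U a
    proof -
      have sp: "space ?R = \<Xi>" by (simp add: space_restrict_space)
      show ?thesis
        using sets_exists_less_continuous_integrand[OF that, of X "\<lambda>p \<xi>. - c0 p \<xi>" ?R a]
        by (simp add: sp c0_meas continuous_on_minus[OF c0_cont])
    qed
  qed

  \<comment> \<open>The limit hypotheses for all sequences off one null set\<close>
  define V where "V \<omega> y u l \<longleftrightarrow> (\<forall>\<nu>::nat. (y \<nu>, u \<nu>) \<in> X \<times> X) \<and> l \<in> X \<and>
      (x_inf \<omega> \<in> X \<longrightarrow> (\<lambda>\<nu>. (y \<nu>, u \<nu>)) \<longlonglongrightarrow> (l, x_inf \<omega>))" for \<omega> y u l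
  have x_inf_X: "AE \<omega> in M. x_inf \<omega> \<in> X"
  proof -
    have "AE \<omega> in M. \<omega> \<in> space M" by simp
    with assms(10) show ?thesis
    proof eventually_elim
      case (elim \<omega>)
      then obtain r where r: "range r \<subseteq> \<kappa>" "(\<lambda>i. x (r i) \<omega>) \<longlonglongrightarrow> x_inf \<omega>"
        by (auto simp: acc_point_along_def o_def)
      have "x (r i) \<omega> \<in> X" for i using r(1) assms(7) elim by (intro x_in) auto
      with closed_sequentially[OF closed_X _ r(2)] show ?case by blast
    qed
  qed
  have V_ex: "\<exists>y u. V \<omega> y u (x_inf \<omega>)" if "x_inf \<omega> \<in> X" for \<omega>
    using that by (intro exI[of _ "\<lambda>_. x_inf \<omega>"]) (simp add: V_def)
  \<comment> \<open>\<open>x_inf \<omega>\<close> lies in \<open>X\<close> only almost surely, yet a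
    selection must exist at every point of the space. Outside \<open>X\<close>, \<open>V\<close>
    asks for no convergence and constant sequences will do.\<close>
  have V_ex': "\<exists>y u l. V \<omega> y u l" if "\<omega> \<in> space M" for \<omega>
  proof (cases "x_inf \<omega> \<in> X")
    case False
    then show ?thesis using x_in[of 1 \<omega>] that
      by (intro exI[of _ "\<lambda>_. x 1 \<omega>"] exI[of _ "x 1 \<omega>"]) (simp add: V_def)
  qed (use V_ex in blast)
  \<comment> \<open>The limit point is part of the selected triple, so a single null set also serves
    all limits in \<open>X\<close>.\<close>
  have upper: "AE \<omega> in M. \<forall>k\<in>{1..K}. \<forall>t. V \<omega> (fst t) (fst (snd t)) (snd (snd t)) \<longrightarrow>
      Limsup (along \<kappa>) (\<lambda>\<nu>. ereal (sample_avg (N \<nu>) z \<omega> (\<lambda>\<xi>. hc k (fst t \<nu>) \<xi> (gam \<nu>) (fst (snd t) \<nu>))))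
        \<le> ereal (expect M zt (\<lambda>\<xi>. ct k (snd (snd t)) \<xi> (x_inf \<omega>)))"
  proof (rule AE_finite_allI, simp, rule AE_all_selections)
    show "\<exists>t. V \<omega> (fst t) (fst (snd t)) (snd (snd t))" if "\<omega> \<in> space M" for \<omega>
      using V_ex'[OF that] by auto
    fix k and s assume k: "k \<in> {1..K}"
      and s: "\<And>\<omega>. \<omega> \<in> space M \<Longrightarrow> V \<omega> (fst (s \<omega>)) (fst (snd (s \<omega>))) (snd (snd (s \<omega>)))"
    have "AE \<omega> in M. \<omega> \<in> space M" by simp
    with x_inf_X have "AE \<omega> in M. (\<lambda>\<nu>. (fst (s \<omega>) \<nu>, fst (snd (s \<omega>)) \<nu>)) \<longlonglongrightarrow> (snd (snd (s \<omega>)), x_inf \<omega>)"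
      by eventually_elim (use s in \<open>auto simp: V_def\<close>)
    then show "AE \<omega> in M. Limsup (along \<kappa>) (\<lambda>\<nu>. ereal (sample_avg (N \<nu>) z \<omega>
        (\<lambda>\<xi>. hc k (fst (s \<omega>) \<nu>) \<xi> (gam \<nu>) (fst (snd (s \<omega>)) \<nu>))))
        \<le> ereal (expect M zt (\<lambda>\<xi>. ct k (snd (snd (s \<omega>))) \<xi> (x_inf \<omega>)))"
      using s by (intro assms(13)[OF assms(5) k]) (auto simp: V_def)
  qed
  \<comment> \<open>\<open>V\<close> with last argument \<open>x_inf \<omega>\<close> fails when
    that point is outside \<open>X\<close>, hence the guard; membership of the sequences in
    \<open>X\<close> is kept as a separate conjunct so that it holds everywhere.\<close>
  have lower: "AE \<omega> in M. \<forall>k\<in>{1..K}. \<forall>t. (x_inf \<omega> \<in> X \<longrightarrow> V \<omega> (fst t) (snd t) (x_inf \<omega>)) \<and>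
      (\<forall>\<nu>. (fst t \<nu>, snd t \<nu>) \<in> X \<times> X) \<longrightarrow>
      ereal (expect M zt (\<lambda>\<xi>. ct k (x_inf \<omega>) \<xi> (x_inf \<omega>))) \<le>
      Liminf (along \<kappa>) (\<lambda>\<nu>. ereal (sample_avg (N \<nu>) z \<omega> (\<lambda>\<xi>. hc k (fst t \<nu>) \<xi> (gam \<nu>) (snd t \<nu>))))"
  proof (rule AE_finite_allI, simp, rule AE_all_selections)
    show "\<exists>t. (x_inf \<omega> \<in> X \<longrightarrow> V \<omega> (fst t) (snd t) (x_inf \<omega>)) \<and> (\<forall>\<nu>. (fst t \<nu>, snd t \<nu>) \<in> X \<times> X)"
      if "\<omega> \<in> space M" for \<omega>
    proof (cases "x_inf \<omega> \<in> X")
      case True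
      then show ?thesis using V_ex[of \<omega>] by (auto simp: V_def)
    next
      case False
      then show ?thesis using x_in[of 1 \<omega>] that
        by (intro exI[of _ "(\<lambda>_. x 1 \<omega>, \<lambda>_. x 1 \<omega>)"]) simp
    qed
    fix k and s assume k: "k \<in> {1..K}"
      and s: "\<And>\<omega>. \<omega> \<in> space M \<Longrightarrow> (x_inf \<omega> \<in> X \<longrightarrow> V \<omega> (fst (s \<omega>)) (snd (s \<omega>)) (x_inf \<omega>)) \<and>
        (\<forall>\<nu>. (fst (s \<omega>) \<nu>, snd (s \<omega>) \<nu>) \<in> X \<times> X)"
    have "AE \<omega> in M. \<omega> \<in> space M" by simp
    with x_inf_X have "AE \<omega> in M. (\<lambda>\<nu>. (fst (s \<omega>) \<nu>, snd (s \<omega>) \<nu>)) \<longlonglongrightarrow> (x_inf \<omega>, x_inf \<omega>)"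
      by eventually_elim (use s in \<open>auto simp: V_def\<close>)
    then show "AE \<omega> in M. ereal (expect M zt (\<lambda>\<xi>. ct k (x_inf \<omega>) \<xi> (x_inf \<omega>))) \<le>
      Liminf (along \<kappa>) (\<lambda>\<nu>. ereal (sample_avg (N \<nu>) z \<omega> (\<lambda>\<xi>. hc k (fst (s \<omega>) \<nu>) \<xi> (gam \<nu>) (snd (s \<omega>) \<nu>))))"
      using s by (intro assms(12)[OF assms(5) k]) auto
  qed

  \<comment> \<open>Asymptotics of the penalty and proximal parameters\<close>
  have par: "strict_mono N" "mono_on {1..} lam" "\<And>\<nu>. \<nu> \<ge> 1 \<Longrightarrow> 0 < lam \<nu>" "lam 1 = 1"
    "(\<lambda>\<nu>. ereal (lam \<nu>)) \<longlonglongrightarrow> lam_inf" "\<And>\<nu>. \<nu> \<ge> 1 \<Longrightarrow> 0 < rho \<nu>" "rho \<longlonglongrightarrow> rho_inf"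
    using assms(3) by (auto simp: spsa_parameters_def)
  obtain \<alpha> where \<alpha>: "\<And>\<nu>. \<nu> \<ge> 1 \<Longrightarrow> rho \<nu> / lam \<nu> \<le> \<alpha> / real \<nu>"
    using assms(3) unfolding spsa_parameters_def by blast
  have lam_ge: "1 \<le> lam \<nu>" if "\<nu> \<ge> 1" for \<nu>
    using mono_onD[OF par(2), of 1 \<nu>] that par(4) by simp
  then obtain a where a: "(\<lambda>\<nu>. 1 / lam \<nu>) \<longlonglongrightarrow> a" "1 / lam_inf = ereal a"
    using ereal_limit_reciprocal[OF par(5)] eventually_ge_at_top[of 1] by (metis (no_types, lifting) eventually_mono)
  \<comment> \<open>The bound \<open>\<alpha> / real \<nu>\<close> lets the proximal term vanish
    after division by the penalty parameter, even when \<open>rho_inf\<close> is positive.\<close>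
  have ratio: "(\<lambda>\<nu>. rho \<nu> / lam \<nu>) \<longlonglongrightarrow> 0"
  proof (rule tendsto_sandwich[OF _ _ tendsto_const lim_const_over_n])
    show "eventually (\<lambda>\<nu>. 0 \<le> rho \<nu> / lam \<nu>) sequentially"
      using eventually_ge_at_top[of 1]
      by eventually_elim (use par(3,6) in \<open>auto intro!: divide_nonneg_pos less_imp_le\<close>)
    show "eventually (\<lambda>\<nu>. rho \<nu> / lam \<nu> \<le> \<alpha> / real \<nu>) sequentially"
      using eventually_ge_at_top[of 1] by eventually_elim (rule \<alpha>)
  qed

  \<comment> \<open>Pathwise comparison along a convergent subsequence\<close>
  have "AE \<omega> in M. \<omega> \<in> space M" by simp
  with assms(9,10) x_inf_X hc0_lln c0_lln upper lower show ?thesis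
  proof eventually_elim
    case (elim \<omega>)
    define xi where "xi = x_inf \<omega>"
    define obj where "obj y = expect M zt (\<lambda>\<xi>. hc0 y \<xi> xi)" for y
    define con where "con k y = expect M zt (\<lambda>\<xi>. ct k y \<xi> xi)" for k y
    have xi: "xi \<in> X" using elim(3) by (simp add: xi_def)
    obtain r where r: "strict_mono r" "range r \<subseteq> \<kappa>" "(\<lambda>i. x (r i) \<omega>) \<longlonglongrightarrow> xi"
      using elim(2) by (auto simp: acc_point_along_def o_def xi_def)
    have r1: "r i \<ge> 1" for i using r(2) assms(7) by auto
    note r_along = filterlim_along[OF r(1,2)]
    have r_seq: "filterlim r sequentially sequentially" by (rule filterlim_subseq[OF r(1)])
    \<comment> \<open>The laws of large numbers run over all sample sizes; this passes to the sizes
      that the algorithm uses along the subsequence.\<close>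
    have Nr: "filterlim (\<lambda>i. N (r i)) sequentially sequentially"
      using filterlim_compose[OF filterlim_subseq[OF par(1)] r_seq] .
    have "(\<lambda>i. norm (x (r i + 1) \<omega> - x (r i) \<omega>)) \<longlonglongrightarrow> 0"
      by (rule filterlim_compose[OF elim(1) r_along])
    then have "(\<lambda>i. x (r i + 1) \<omega> - x (r i) \<omega>) \<longlonglongrightarrow> 0" by (rule tendsto_norm_zero_cancel)
    from tendsto_add[OF this r(3)] have xp_lim: "(\<lambda>i. x (r i + 1) \<omega>) \<longlonglongrightarrow> xi" by simp
    have xs_X: "x (r i) \<omega> \<in> X" "x (r i + 1) \<omega> \<in> X" for i
      using x_in elim(8) r1 by auto
    \<comment> \<open>The surrogate touches \<open>c0\<close> at its reference point, so the lower
      law for \<open>c0\<close> gives a bound in terms of \<open>obj xi\<close>.\<close>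
    have obj_xi: "obj xi = expect M zt (c0 xi)"
      unfolding obj_def using sur(2) xi P.random_zt(2) by (intro Bochner_Integration.integral_cong) auto
    \<comment> \<open>Both sequences are indexed by the iterate, the second storing its successor at
      the same \<nu>, so that they share the sample size \<open>N \<nu>\<close> and the parameter
      \<open>gam \<nu>\<close> of the subproblem.\<close>
    let ?xu = "\<lambda>\<nu>. if \<nu> \<in> range r then x \<nu> \<omega> else xi"
    let ?xy = "\<lambda>\<nu>. if \<nu> \<in> range r then x (\<nu> + 1) \<omega> else xi"
    have xu: "?xu \<longlonglongrightarrow> xi" "\<And>\<nu>. ?xu \<nu> \<in> X"
      using tendsto_range_subseq[OF r(1,3)] xs_X xi by auto
    have xy: "?xy \<longlonglongrightarrow> xi" "\<And>\<nu>. ?xy \<nu> \<in> X"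
      using tendsto_range_subseq[OF r(1), of "\<lambda>\<nu>. x (\<nu> + 1) \<omega>", OF xp_lim] xs_X xi by auto

    have upper_xi: "Limsup (along \<kappa>) (\<lambda>\<nu>. ereal (sample_avg (N \<nu>) z \<omega> (\<lambda>\<xi>. hc k (y \<nu>) \<xi> (gam \<nu>) (u \<nu>))))
        \<le> ereal (con k l)" if "k \<in> {1..K}" "V \<omega> y u l" for k y u l
      using elim(6)[THEN bspec, OF that(1), THEN spec[of _ "(y, u, l)"]] that(2)
      by (simp add: con_def xi_def)
    have lower_xi: "ereal (con k xi) \<le>
        Liminf (along \<kappa>) (\<lambda>\<nu>. ereal (sample_avg (N \<nu>) z \<omega> (\<lambda>\<xi>. hc k (y \<nu>) \<xi> (gam \<nu>) (u \<nu>))))"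
      if "k \<in> {1..K}" "V \<omega> y u xi" for k y u
      using elim(7)[THEN bspec, OF that(1), THEN spec[of _ "(y, u)"]] that(2)
      by (simp add: con_def xi_def V_def)

    interpret penalty_minimizers X K \<zeta>
      "\<lambda>i y. sample_avg (N (r i)) z \<omega> (\<lambda>\<xi>. hc0 y \<xi> (x (r i) \<omega>))"
      "\<lambda>i k y. sample_avg (N (r i)) z \<omega> (\<lambda>\<xi>. hc k y \<xi> (gam (r i)) (x (r i) \<omega>))"
      "\<lambda>i. lam (r i)" "\<lambda>i. rho (r i)" "\<lambda>i. x (r i) \<omega>" "\<lambda>i. x (r i + 1) \<omega>" xi obj con a rho_inf
    proof
      fix i y assume y: "y \<in> X"
      have "is_arg_min (penalized_avg K \<zeta> hc0 hc (lam (r i)) (rho (r i)) (N (r i)) z \<omega> (gam (r i)) (x (r i) \<omega>))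
          (\<lambda>y. y \<in> X) (x (r i + 1) \<omega>)"
        using assms(6) elim(8) r1 by (simp add: spsa_iterates_def)
      with y show "sample_avg (N (r i)) z \<omega> (\<lambda>\<xi>. hc0 (x (r i + 1) \<omega>) \<xi> (x (r i) \<omega>)) +
          lam (r i) * (\<Sum>k=1..K. max (sample_avg (N (r i)) z \<omega>
            (\<lambda>\<xi>. hc k (x (r i + 1) \<omega>) \<xi> (gam (r i)) (x (r i) \<omega>)) - \<zeta> k) 0) +
          rho (r i) / 2 * (norm (x (r i + 1) \<omega> - x (r i) \<omega>))\<^sup>2
        \<le> sample_avg (N (r i)) z \<omega> (\<lambda>\<xi>. hc0 y \<xi> (x (r i) \<omega>)) +
          lam (r i) * (\<Sum>k=1..K. max (sample_avg (N (r i)) z \<omega>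
            (\<lambda>\<xi>. hc k y \<xi> (gam (r i)) (x (r i) \<omega>)) - \<zeta> k) 0) +
          rho (r i) / 2 * (norm (y - x (r i) \<omega>))\<^sup>2"
        unfolding is_arg_min_linorder penalized_avg_def by blast
    next
      fix e :: real assume e: "0 < e"
      have "expect M zt (\<lambda>\<xi>. - c0 xi \<xi>) < e - obj xi" using e by (simp add: obj_xi)
      then obtain U where U: "open U" "xi \<in> U"
        "eventually (\<lambda>n. \<forall>q\<in>U \<inter> X. sample_avg n z \<omega> (\<lambda>\<xi>. - c0 q \<xi>) < e - obj xi) sequentially"
        using elim(5) xi by blast
      \<comment> \<open>The bound is uniform on a neighbourhood of \<open>xi\<close>, which is what
        allows it to be evaluated at a moving iterate that itself depends on the samples.\<close>
      from filterlim_iff[THEN iffD1, OF Nr, rule_format, OF U(3)] topological_tendstoD[OF xp_lim U(1,2)]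
      show "eventually (\<lambda>i. obj xi - e < sample_avg (N (r i)) z \<omega> (\<lambda>\<xi>. hc0 (x (r i + 1) \<omega>) \<xi> (x (r i) \<omega>))) sequentially"
      proof eventually_elim
        case (elim i)
        have "sample_avg (N (r i)) z \<omega> (c0 (x (r i + 1) \<omega>))
            \<le> sample_avg (N (r i)) z \<omega> (\<lambda>\<xi>. hc0 (x (r i + 1) \<omega>) \<xi> (x (r i) \<omega>))"
          unfolding sample_avg_def using z_in \<open>\<omega> \<in> space M\<close> xs_X
          by (intro divide_right_mono sum_mono sur(1)) auto
        moreover have "sample_avg (N (r i)) z \<omega> (\<lambda>\<xi>. - c0 (x (r i + 1) \<omega>) \<xi>) =
            - sample_avg (N (r i)) z \<omega> (c0 (x (r i + 1) \<omega>))"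
          by (simp add: sample_avg_def sum_negf)
        moreover have "sample_avg (N (r i)) z \<omega> (\<lambda>\<xi>. - c0 (x (r i + 1) \<omega>) \<xi>) < e - obj xi"
          using elim xs_X by blast
        ultimately show ?case by linarith
      qed
    next
      fix y and e :: real assume y: "y \<in> X" and e: "0 < e"
      have "expect M zt (\<lambda>\<xi>. hc0 (fst (y, xi)) \<xi> (snd (y, xi))) < obj y + e"
        using e by (simp add: obj_def)
      then obtain U where U: "open U" "(y, xi) \<in> U"
        "eventually (\<lambda>n. \<forall>q\<in>U \<inter> X \<times> X. sample_avg n z \<omega> (\<lambda>\<xi>. hc0 (fst q) \<xi> (snd q)) < obj y + e) sequentially"
        using elim(4) xi y by blast
      have "(\<lambda>i. (y, x (r i) \<omega>)) \<longlonglongrightarrow> (y, xi)" by (intro tendsto_intros r(3))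
      from filterlim_iff[THEN iffD1, OF Nr, rule_format, OF U(3)] topological_tendstoD[OF this U(1,2)]
      show "eventually (\<lambda>i. sample_avg (N (r i)) z \<omega> (\<lambda>\<xi>. hc0 y \<xi> (x (r i) \<omega>)) < obj y + e) sequentially"
      proof eventually_elim
        case (elim i)
        then have "(y, x (r i) \<omega>) \<in> U \<inter> X \<times> X" using xs_X(1) y by simp
        with elim(1) have "sample_avg (N (r i)) z \<omega> (\<lambda>\<xi>. hc0 (fst (y, x (r i) \<omega>)) \<xi> (snd (y, x (r i) \<omega>))) < obj y + e"
          by (rule bspec)
        then show ?case by simp
      qed
    next
      fix k and e :: real assume k: "k \<in> {1..K}" and e: "0 < e"
      have "V \<omega> ?xy ?xu xi"
        unfolding V_def using xy xu xi by (auto intro!: tendsto_Pair simp: xi_def)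
      then have "ereal (con k xi) \<le> Liminf (along \<kappa>)
          (\<lambda>\<nu>. ereal (sample_avg (N \<nu>) z \<omega> (\<lambda>\<xi>. hc k (?xy \<nu>) \<xi> (gam \<nu>) (?xu \<nu>))))"
        by (rule lower_xi[OF k])
      moreover have "ereal (con k xi - e) < ereal (con k xi)" using e by simp
      ultimately have "eventually (\<lambda>\<nu>. ereal (con k xi - e) <
          ereal (sample_avg (N \<nu>) z \<omega> (\<lambda>\<xi>. hc k (?xy \<nu>) \<xi> (gam \<nu>) (?xu \<nu>)))) (along \<kappa>)"
        by (intro less_LiminfD) (rule less_le_trans)
      \<comment> \<open>\<open>r\<close> tends to infinity inside \<kappa>, so the eventual bound
        pulls back; at the indices \<open>r i\<close> the filled-in sequences are the iterate and
        its successor.\<close>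
      from filterlim_iff[THEN iffD1, OF r_along, rule_format, OF this]
      show "eventually (\<lambda>i. con k xi - e < sample_avg (N (r i)) z \<omega>
          (\<lambda>\<xi>. hc k (x (r i + 1) \<omega>) \<xi> (gam (r i)) (x (r i) \<omega>))) sequentially"
        by simp
    next
      fix k y and e :: real assume k: "k \<in> {1..K}" and y: "y \<in> X" and e: "0 < e"
      have "V \<omega> (\<lambda>_. y) ?xu y"
        unfolding V_def using xu y by (auto intro!: tendsto_Pair simp: xi_def)
      then have "Limsup (along \<kappa>)
          (\<lambda>\<nu>. ereal (sample_avg (N \<nu>) z \<omega> (\<lambda>\<xi>. hc k y \<xi> (gam \<nu>) (?xu \<nu>)))) \<le> ereal (con k y)"
        by (rule upper_xi[OF k])
      moreover have "ereal (con k y) < ereal (con k y + e)" using e by simp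
      ultimately have "eventually (\<lambda>\<nu>. ereal (sample_avg (N \<nu>) z \<omega> (\<lambda>\<xi>. hc k y \<xi> (gam \<nu>) (?xu \<nu>)))
          < ereal (con k y + e)) (along \<kappa>)"
        by (intro Limsup_lessD) (rule le_less_trans)
      from filterlim_iff[THEN iffD1, OF r_along, rule_format, OF this]
      show "eventually (\<lambda>i. sample_avg (N (r i)) z \<omega>
          (\<lambda>\<xi>. hc k y \<xi> (gam (r i)) (x (r i) \<omega>)) < con k y + e) sequentially"
        by simp
    next
      show "0 < lam (r i)" "0 < rho (r i)" for i using par(3,6) r1 by auto
      show "(\<lambda>i. 1 / lam (r i)) \<longlonglongrightarrow> a" by (rule filterlim_compose[OF a(1) r_seq])
      show "(\<lambda>i. rho (r i) / lam (r i)) \<longlonglongrightarrow> 0" by (rule filterlim_compose[OF ratio r_seq])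
      show "(\<lambda>i. rho (r i)) \<longlonglongrightarrow> rho_inf" by (rule filterlim_compose[OF par(7) r_seq])
      show "(\<lambda>i. x (r i) \<omega>) \<longlonglongrightarrow> xi" by (rule r(3))
    qed

    \<comment> \<open>Feasibility and B-stationarity of the accumulation point\<close>
    let ?xhat = "\<exists>xh\<in>X. (\<forall>k\<in>{1..K}. con k xh \<le> \<zeta> k) \<and> 1 / lam_inf * ereal (obj xh) \<le> 1 / lam_inf * ereal (obj xi)"
    let ?F = "{y\<in>X. \<forall>k\<in>{1..K}. con k y \<le> \<zeta> k}"
    let ?S = "{y\<in>X. \<forall>k\<in>{1..K}. con k y < \<zeta> k}"
    have feas: "\<forall>k\<in>{1..K}. con k xi \<le> \<zeta> k" if ?xhat
      using that feasible_limit by (auto simp: a(2))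
    have stat: "B_stationary (\<lambda>y. obj y + rho_inf / 2 * (norm (y - xi))\<^sup>2) ?F xi"
      if xhat: "?xhat" and dense: "?F \<subseteq> closure ?S"
    proof (rule B_stationary_proximal_minimizer)
      show "xi \<in> ?F" using feas[OF xhat] xi by simp
      have B_diff: "B_differentiable obj y" if "y \<in> X" for y
        using reg(2)[OF xi that] by (simp add: obj_def[abs_def])
      show "B_differentiable obj xi" by (rule B_diff[OF xi])
      fix y assume y: "y \<in> ?F"
      \<comment> \<open>\<open>minimal_limit\<close> covers strictly feasible points only; the
        closure condition supplies such points tending to \<open>y\<close>, and continuity of
        \<open>obj\<close>, from its B-differentiability, carries the inequality over.\<close>
      then obtain s where s: "\<And>n::nat. s n \<in> ?S" "s \<longlonglongrightarrow> y"
        using dense closure_sequential[of y ?S] by blast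
      have "isCont obj y" by (rule B_differentiable_imp_isCont[OF B_diff]) (use y in simp)
      note obj_lim = isCont_tendsto_compose[OF this s(2)]
      have "(\<lambda>n. obj (s n) + rho_inf / 2 * (norm (s n - xi))\<^sup>2) \<longlonglongrightarrow> obj y + rho_inf / 2 * (norm (y - xi))\<^sup>2"
        by (intro tendsto_intros s(2) obj_lim) auto
      moreover have "obj xi \<le> obj (s n) + rho_inf / 2 * (norm (s n - xi))\<^sup>2" for n
        using s(1)[of n] by (intro minimal_limit) auto
      ultimately show "obj xi \<le> obj y + rho_inf / 2 * (norm (y - xi))\<^sup>2"
        by (intro LIMSEQ_le_const) auto
    qed
    show ?case
      using feas stat unfolding Let_def obj_def[abs_def] con_def[abs_def] xi_def by blast
  qed
qed

end
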